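(* Let $r\ge3$ be a fixed integer and let $\omega=\omega(q)$ be any positive function with $\omega\to\infty$. Then, as $q\to\infty$ (over orders $q$ of projective planes $\Pi_q$), the following hold with probability tending to $1$: (a) if $p=q^{-\frac{r+2}{r}}/\omega$, then $\Pi_q(p)$ does not percolate; (b) if $p=q^{-\frac{r+2}{r}}\omega$, then $\Pi_q(p)$ percolates; (c) $\tau_r(\Pi_q)=\tau_{perc,r}(\Pi_q)$.
   Context: A finite projective plane $\Pi_q$ of order $q\ge 2$ has $q^2+q+1$ points and $q^2+q+1$ lines; every line contains $q+1$ points, every point lies on $q+1$ lines, any two lines meet in exactly one point and any two points lie on exactly one line. $r$-neighbor line percolation: for a set $A$ of points let $A^0=A$ and for $s\ge1$ let $A^s=A^{s-1}\cup\{P: \exists \text{ line } l\ni P \text{ with } |l\cap A^{s-1}|\ge r\}$; $A$ percolates if $A^k$ equals the whole point set for some $k$. $\Pi_q(p)$ is the random point set containing each point of $\Pi_q$ independently with probability $p$. Let $(P_1,\dots,P_{q^2+q+1})$ be a uniformly random ordering of the points of $\Pi_q$; $\tau_r(\Pi_q)$ is the least $i$ such that some line contains $r$ of the points $P_1,\dots,P_i$, and $\tau_{perc,r}(\Pi_q)$ is the least $i$ such that $\{P_1,\dots,P_i\}$ percolates. *)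

theory Defs
  imports "HOL-Probability.Probability" "HOL-Combinatorics.Multiset_Permutations"
begin

text \<open>A line is identified with the set of points incident with it.\<close>

locale finite_projective_plane =
  fixes q :: nat and P :: "'a set" and L :: "'a set set"
  assumes order_ge_2: "q \<ge> 2"
    and finite_points: "finite P"
    and finite_lines: "finite L"
    and card_points: "card P = q\<^sup>2 + q + 1"
    and card_lines: "card L = q\<^sup>2 + q + 1"
    and line_subset: "l \<in> L \<Longrightarrow> l \<subseteq> P"
    and card_line: "l \<in> L \<Longrightarrow> card l = q + 1"
    and card_lines_through: "x \<in> P \<Longrightarrow> card {l \<in> L. x \<in> l} = q + 1"
    and lines_meet: "l \<in> L \<Longrightarrow> m \<in> L \<Longrightarrow> l \<noteq> m \<Longrightarrow> \<exists>!x. x \<in> P \<and> x \<in> l \<and> x \<in> m"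
    and points_join: "x \<in> P \<Longrightarrow> y \<in> P \<Longrightarrow> x \<noteq> y \<Longrightarrow> \<exists>!l. l \<in> L \<and> x \<in> l \<and> y \<in> l"

definition perc_step :: "nat \<Rightarrow> 'a set \<Rightarrow> 'a set set \<Rightarrow> 'a set \<Rightarrow> 'a set" where
  "perc_step r P L A = A \<union> {x \<in> P. \<exists>l\<in>L. x \<in> l \<and> card (l \<inter> A) \<ge> r}"

definition percolates :: "nat \<Rightarrow> 'a set \<Rightarrow> 'a set set \<Rightarrow> 'a set \<Rightarrow> bool" where
  "percolates r P L A \<longleftrightarrow> (\<exists>k. (perc_step r P L ^^ k) A = P)"

text \<open>For \<open>p\<close> outside \<open>[0,1]\<close> the library's \<^const>\<open>bernoulli_pmf\<close> truncates the parameter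
  to that interval, so \<open>p > 1\<close> yields the full point set.\<close>

definition random_points :: "'a set \<Rightarrow> real \<Rightarrow> 'a set pmf" where
  "random_points P p =
     map_pmf (\<lambda>f. {x \<in> P. f x}) (Pi_pmf P False (\<lambda>_. bernoulli_pmf p))"

definition random_ordering :: "'a set \<Rightarrow> 'a list pmf" where
  "random_ordering P = pmf_of_set (permutations_of_set P)"

text \<open>The hitting time \<open>tau_line\<close> is only meaningful when \<open>r \<le> q + 1\<close>: otherwise no line
  contains \<open>r\<close> points and the value of \<^const>\<open>Least\<close> is unspecified.\<close>

definition tau_line :: "nat \<Rightarrow> 'a set set \<Rightarrow> 'a list \<Rightarrow> nat" where
  "tau_line r L xs = (LEAST i. \<exists>l\<in>L. card (l \<inter> set (take i xs)) \<ge> r)"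

definition tau_perc :: "nat \<Rightarrow> 'a set \<Rightarrow> 'a set set \<Rightarrow> 'a list \<Rightarrow> nat" where
  "tau_perc r P L xs = (LEAST i. percolates r P L (set (take i xs)))"

end

theory Submission
  imports Defs
begin

text \<open>
  A uniformly random ordering is cut into \<open>(r - 1)\<^sup>2 + r\<close> initial blocks of length about
  \<open>q powr (1 - 2 / r - 1 / r\<^sup>2)\<close>. By the second moment method every block contains \<open>r - 1\<close>
  collinear points, while by the union bound no line contains \<open>r\<close> points of their union.
  When the first line \<open>m\<close> receives its \<open>r\<close>-th point, it becomes full, and at most \<open>r - 1\<close> of the
  collinear \<open>(r - 1)\<close>-sets meet \<open>m\<close>; the lines of the others gain an \<open>r\<close>-th point on \<open>m\<close> and become
  full as well. Among \<open>(r - 1)\<^sup>2 + 1\<close> full lines, a line that is not full meets them in fewer than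
  \<open>r\<close> points, so \<open>r\<close> of them are concurrent, and these fill the plane. This is (c).
  Part (a) is the union bound over collinear \<open>r\<close>-sets. For (b), the random set is a prefix of a
  random ordering whose length is concentrated around its mean, and a prefix of half that length
  contains \<open>r\<close> collinear points by the second moment method, so (c) applies.
\<close>

section \<open>Random orderings and random sets\<close>

text \<open>The obstacle in (c) is that a full line \<open>m\<close> completes a line with
  \<open>r - 1\<close> chosen points only if their intersection point is new; if it is one of these
  \<open>r - 1\<close> points, nothing is gained. Taking the \<open>(r - 1)\<close>-sets from blocks
  at disjoint positions makes them disjoint without any estimate of overlaps, so every early point
  on \<open>m\<close> spoils at most one of them, and fewer than \<open>r\<close> early points lie
  on \<open>m\<close>. This dictates the number of blocks: \<open>(r - 1)\<^sup>2 + r\<close> minus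
  at most \<open>r - 1\<close> leaves \<open>(r - 1)\<^sup>2 + 1\<close>, one more than a pigeonhole
  over \<open>r - 1\<close> points can absorb. The blocks are dependent, but only a union bound over
  their separate failures is taken. The second moment method works for two reasons: positions in an
  ordering are sampled without replacement, so disjoint sets are negatively correlated, and two
  lines share a single point, so positive correlation is confined to sets on the same line or
  through a common point.\<close>

lemma second_moment_bound:
  fixes M :: "'b pmf" and E :: "'i \<Rightarrow> 'b set" and c :: real
  assumes "finite I" and c: "c < (\<Sum>i\<in>I. measure_pmf.prob M (E i))"
  shows "measure_pmf.prob M {w. (\<Sum>i\<in>I. indicator (E i) w) \<le> c}
    \<le> ((\<Sum>i\<in>I. \<Sum>j\<in>I. measure_pmf.prob M (E i \<inter> E j)) - (\<Sum>i\<in>I. measure_pmf.prob M (E i))\<^sup>2)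
        / ((\<Sum>i\<in>I. measure_pmf.prob M (E i)) - c)\<^sup>2"
proof -
  define \<mu> where "\<mu> = (\<Sum>i\<in>I. measure_pmf.prob M (E i))"
  define Z :: "'b \<Rightarrow> real" where "Z = (\<lambda>w. \<Sum>i\<in>I. indicator (E i) w)"
  have int_Z: "integrable (measure_pmf M) Z"
    unfolding Z_def by (intro Bochner_Integration.integrable_sum integrable_real_indicator)
      (auto simp: less_top[symmetric])
  have Z2: "(\<lambda>w. (Z w)\<^sup>2) = (\<lambda>w. \<Sum>i\<in>I. \<Sum>j\<in>I. indicator (E i \<inter> E j) w)"
    by (simp add: Z_def power2_eq_square sum_product indicator_inter_arith)
  have int_Z2: "integrable (measure_pmf M) (\<lambda>w. (Z w)\<^sup>2)"
    unfolding Z2 by (intro Bochner_Integration.integrable_sum integrable_real_indicator)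
      (auto simp: less_top[symmetric])
  have EZ: "measure_pmf.expectation M Z = \<mu>"
    unfolding Z_def \<mu>_def by (subst Bochner_Integration.integral_sum)
      (auto intro!: integrable_real_indicator simp: less_top[symmetric])
  have EZ2: "measure_pmf.expectation M (\<lambda>w. (Z w)\<^sup>2)
      = (\<Sum>i\<in>I. \<Sum>j\<in>I. measure_pmf.prob M (E i \<inter> E j))"
    unfolding Z2
  proof (subst Bochner_Integration.integral_sum)
    show "integrable (measure_pmf M) (\<lambda>w. \<Sum>j\<in>I. indicat_real (E i \<inter> E j) w)" for i
      by (intro Bochner_Integration.integrable_sum integrable_real_indicator)
        (auto simp: less_top[symmetric])
    show "(\<Sum>i\<in>I. measure_pmf.expectation M (\<lambda>w. \<Sum>j\<in>I. indicat_real (E i \<inter> E j) w))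
      = (\<Sum>i\<in>I. \<Sum>j\<in>I. measure_pmf.prob M (E i \<inter> E j))"
      by (subst Bochner_Integration.integral_sum) (auto intro!: integrable_real_indicator
          simp: less_top[symmetric] simp del: indicator_inter_arith)
  qed
  \<comment> \<open>Chebyshev at distance \<open>\<mu> - c\<close> from the mean. The level
    \<open>c\<close> is 0 when collinear sets are counted and half the mean when the size of a
    random set is bounded below.\<close>
  have "measure_pmf.prob M {w. Z w \<le> c} \<le> measure_pmf.prob M {w \<in> space M. \<mu> - c \<le> \<bar>Z w - measure_pmf.expectation M Z\<bar>}"
    using c by (intro measure_pmf.finite_measure_mono) (auto simp: EZ \<mu>_def)
  also have "\<dots> \<le> measure_pmf.variance M Z / (\<mu> - c)\<^sup>2"
    using c by (intro measure_pmf.Chebyshev_inequality int_Z2) (auto simp: \<mu>_def)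
  also have "measure_pmf.variance M Z = measure_pmf.expectation M (\<lambda>w. (Z w)\<^sup>2) - \<mu>\<^sup>2"
    using measure_pmf.variance_eq[OF int_Z int_Z2] by (simp add: EZ)
  finally show ?thesis
    unfolding EZ2 unfolding Z_def \<mu>_def .
qed

text \<open>Relabelling entries by a bijection of \<open>P\<close> that carries \<open>B\<close>
  onto \<open>B'\<close> permutes the orderings and leaves the positions \<open>I\<close>
  untouched.\<close>

lemma card_perms_covering_cong:
  fixes P B B' :: "'a set"
  assumes "finite P" "I \<subseteq> {..<card P}" "B \<subseteq> P" "B' \<subseteq> P" "card B = card B'"
  shows "card {xs \<in> permutations_of_set P. B \<subseteq> nth xs ` I}
       = card {xs \<in> permutations_of_set P. B' \<subseteq> nth xs ` I}"
proof -
  have fin: "finite B" "finite B'" "finite (P - B)" "finite (P - B')"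
    using assms by (auto intro: finite_subset)
  obtain g where g: "bij_betw g B B'"
    using finite_same_card_bij[OF fin(1,2)] assms(5) by blast
  obtain h where h: "bij_betw h (P - B) (P - B')"
    using finite_same_card_bij[OF fin(3,4)] assms by (metis card_Diff_subset fin(1,2))
  define f where "f = (\<lambda>x. if x \<in> B then g x else h x)"
  have "bij_betw f B B'"
    using g by (simp add: f_def cong: bij_betw_cong)
  moreover have "bij_betw f (P - B) (P - B')"
    by (rule bij_betw_cong[THEN iffD1, OF _ h]) (simp add: f_def)
  ultimately have "bij_betw f (B \<union> (P - B)) (B' \<union> (P - B'))"
    by (intro bij_betw_combine) auto
  then have bij: "bij_betw f P P"
    using assms by (simp add: Un_absorb1)
  then have inj: "inj_on f P" and im: "f ` P = P"
    by (auto simp: bij_betw_def)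
  have fB: "f ` B = B'"
    using \<open>bij_betw f B B'\<close> by (auto simp: bij_betw_def)
  have perms: "permutations_of_set P = map f ` permutations_of_set P"
    using permutations_of_set_image_inj[OF inj] by (simp add: im)
  have eq: "(B' \<subseteq> nth (map f xs) ` I) \<longleftrightarrow> (B \<subseteq> nth xs ` I)" if "xs \<in> permutations_of_set P" for xs
  proof -
    have len: "length xs = card P" "set xs = P"
      using that by (auto simp: length_finite_permutations_of_set permutations_of_setD)
    have sub: "nth xs ` I \<subseteq> P"
      using len assms(2) nth_mem by (metis image_subsetI lessThan_iff subset_iff)
    have "nth (map f xs) ` I = f ` nth xs ` I"
      using assms(2) len by (force simp: image_image)
    then show ?thesis
      using inj_on_image_subset_iff[OF inj \<open>B \<subseteq> P\<close> sub] fB by simp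
  qed
  have "{xs \<in> permutations_of_set P. B' \<subseteq> nth xs ` I}
      = map f ` {xs \<in> permutations_of_set P. B \<subseteq> nth xs ` I}"
    by (subst perms) (use eq in auto)
  moreover have "inj_on (map f) {xs \<in> permutations_of_set P. B \<subseteq> nth xs ` I}"
    by (rule inj_on_subset[OF inj_on_mapI[of f "permutations_of_set P"]])
       (use inj in \<open>auto simp: permutations_of_setD intro!: inj_on_subset[OF inj]\<close>)
  ultimately show ?thesis
    by (simp add: card_image)
qed

text \<open>Double counting of pairs of an ordering and a \<open>card B\<close>-subset inside the
  entries at \<open>I\<close>: every ordering has the same number of such subsets, and by
  relabelling every subset has the same number of such orderings.\<close>

lemma prob_random_ordering_covers:
  fixes P B :: "'a set"
  assumes "finite P" "I \<subseteq> {..<card P}" "B \<subseteq> P"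
  shows "measure_pmf.prob (random_ordering P) {xs. B \<subseteq> nth xs ` I}
       = real (card I choose card B) / real (card P choose card B)"
proof -
  define \<O> where "\<O> = permutations_of_set P"
  define \<B> where "\<B> = {C. C \<subseteq> P \<and> card C = card B}"
  have fin: "finite \<O>" "finite \<B>" "finite I" "\<O> \<noteq> {}"
    using assms by (auto simp: \<O>_def \<B>_def finite_subset)
  have "card \<O> * (card I choose card B) = (\<Sum>xs\<in>\<O>. card {C \<in> \<B>. C \<subseteq> nth xs ` I})"
  proof -
    have "card {C \<in> \<B>. C \<subseteq> nth xs ` I} = card I choose card B" if "xs \<in> \<O>" for xs
    proof -
      have len: "length xs = card P" "set xs = P" "distinct xs"
        using that by (auto simp: \<O>_def length_finite_permutations_of_set permutations_of_setD)
      have sub: "nth xs ` I \<subseteq> P"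
        using len assms(2) nth_mem by (metis image_subsetI lessThan_iff subset_iff)
      have "inj_on (nth xs) I"
        by (rule inj_on_nth) (use len assms(2) in auto)
      then have "card (nth xs ` I) = card I"
        by (rule card_image)
      moreover have "{C \<in> \<B>. C \<subseteq> nth xs ` I} = {C. C \<subseteq> nth xs ` I \<and> card C = card B}"
        using sub by (auto simp: \<B>_def)
      ultimately show ?thesis
        using n_subsets[of "nth xs ` I" "card B"] fin by simp
    qed
    then show ?thesis by simp
  qed
  also have "\<dots> = (\<Sum>C\<in>\<B>. card {xs \<in> \<O>. C \<subseteq> nth xs ` I})"
    using fin by (intro sum_multicount_gen) auto
  also have "\<dots> = (\<Sum>C\<in>\<B>. card {xs \<in> \<O>. B \<subseteq> nth xs ` I})"
    unfolding \<O>_def using assms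
    by (intro sum.cong refl card_perms_covering_cong) (auto simp: \<B>_def)
  also have "\<dots> = (card P choose card B) * card {xs \<in> \<O>. B \<subseteq> nth xs ` I}"
    using n_subsets[OF assms(1)] by (simp add: \<B>_def)
  finally have count: "real (card \<O>) * real (card I choose card B)
      = real (card P choose card B) * real (card {xs \<in> \<O>. B \<subseteq> nth xs ` I})"
    by (metis of_nat_mult)
  have pos: "real (card P choose card B) > 0"
    using assms by (simp add: card_mono)
  have pos': "real (card \<O>) > 0"
    using fin by (simp add: card_gt_0_iff)
  have "measure_pmf.prob (random_ordering P) {xs. B \<subseteq> nth xs ` I}
      = real (card {xs \<in> \<O>. B \<subseteq> nth xs ` I}) / real (card \<O>)"
    using fin unfolding random_ordering_def \<O>_def
    by (subst measure_pmf_of_set) (auto simp: Int_def)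
  also have "\<dots> = real (card I choose card B) / real (card P choose card B)"
    using count pos pos' unfolding frac_eq_eq[OF pos'[THEN less_imp_neq, symmetric] pos[THEN less_imp_neq, symmetric]]
    by (simp add: mult.commute)
  finally show ?thesis .
qed

lemma prob_random_points_covers:
  fixes P B :: "'a set"
  assumes "finite P" "B \<subseteq> P" "0 \<le> p" "p \<le> 1"
  shows "measure_pmf.prob (random_points P p) {A. B \<subseteq> A} = p ^ card B"
proof -
  have "measure_pmf.prob (random_points P p) {A. B \<subseteq> A}
      = measure_pmf.prob (Pi_pmf P False (\<lambda>_. bernoulli_pmf p)) (Pi P (\<lambda>x. if x \<in> B then {True} else UNIV))"
    unfolding random_points_def measure_map_pmf
    using assms(2) by (intro arg_cong2[where f = measure] refl) (auto simp: Pi_def)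
  also have "\<dots> = (\<Prod>x\<in>P. if x \<in> B then p else 1)"
    using assms by (subst measure_Pi_pmf_Pi) (auto simp: measure_pmf_single intro!: prod.cong)
  also have "\<dots> = (\<Prod>x\<in>B. p)"
    using assms by (subst prod.inter_restrict[symmetric]) (auto simp: Int_absorb1)
  finally show ?thesis by simp
qed

lemma set_pmf_random_points: "finite P \<Longrightarrow> A \<in> set_pmf (random_points P p) \<Longrightarrow> A \<subseteq> P"
  by (auto simp: random_points_def)

lemma pmf_random_points_cong_card:
  fixes P A B :: "'a set"
  assumes "finite P" "A \<subseteq> P" "B \<subseteq> P" "card A = card B" "0 \<le> p" "p \<le> 1"
  shows "pmf (random_points P p) A = pmf (random_points P p) B"
proof -
  have pmf_eq: "pmf (random_points P p) C = p ^ card C * (1 - p) ^ card (P - C)" if "C \<subseteq> P" for C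
  proof -
    \<comment> \<open>Here \<open>{x \<in> C}\<close> is a one-element set of booleans: the
      coordinate at \<open>x\<close> is forced to the truth value of membership in
      \<open>C\<close>.\<close>
    have "pmf (random_points P p) C
       = measure_pmf.prob (Pi_pmf P False (\<lambda>_. bernoulli_pmf p)) (Pi P (\<lambda>x. {x \<in> C}))"
      unfolding random_points_def pmf_map using that
      by (intro arg_cong2[where f = measure] refl) (auto simp: Pi_def)
    also have "\<dots> = (\<Prod>x\<in>P. if x \<in> C then p else 1 - p)"
      using assms by (subst measure_Pi_pmf_Pi) (auto simp: measure_pmf_single intro!: prod.cong)
    also have "\<dots> = (\<Prod>x\<in>P \<inter> C. p) * (\<Prod>x\<in>P \<inter> - C. 1 - p)"
      using assms(1) by (rule prod.If_cases[of P "\<lambda>x. x \<in> C", simplified])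
    finally show ?thesis
      using that by (simp add: Int_absorb1 Diff_eq)
  qed
  have "card (P - A) = card (P - B)"
    using assms by (metis card_Diff_subset finite_subset)
  then show ?thesis
    using assms by (simp add: pmf_eq)
qed

text \<open>Given its size, an exchangeable set is uniform among the subsets of that size, and so is
  the prefix of that length of a random ordering. Statements on hitting times thereby transfer to
  random sets.\<close>

lemma exchangeable_set_eq_prefix_of_random_ordering:
  fixes P :: "'a set" and D :: "'a set pmf"
  assumes "finite P" and sub: "\<And>A. A \<in> set_pmf D \<Longrightarrow> A \<subseteq> P"
    and exch: "\<And>A B. A \<subseteq> P \<Longrightarrow> B \<subseteq> P \<Longrightarrow> card A = card B \<Longrightarrow> pmf D A = pmf D B"
  shows "D = bind_pmf (map_pmf card D) (\<lambda>N. map_pmf (\<lambda>xs. set (take N xs)) (random_ordering P))"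
proof (rule pmf_eqI)
  fix B
  define R where "R = (\<lambda>N. map_pmf (\<lambda>xs. set (take N xs)) (random_ordering P))"
  define n where "n = card P"
  have perm: "length xs = n" "set xs = P" "distinct xs" if "xs \<in> set_pmf (random_ordering P)" for xs
    using that assms(1)
    by (auto simp: random_ordering_def n_def length_finite_permutations_of_set permutations_of_setD)
  have Nle: "N \<le> n" if "N \<in> set_pmf (map_pmf card D)" for N
    using that sub assms(1) by (auto simp: n_def card_mono)
  have R: "pmf (R N) B = (if B \<subseteq> P \<and> card B = N then 1 / real (n choose N) else 0)" if "N \<le> n" for N
  proof (cases "B \<subseteq> P \<and> card B = N")
    case True
    have "pmf (R N) B = measure_pmf.prob (random_ordering P) {xs. B \<subseteq> nth xs ` {..<N}}"
      unfolding R_def pmf_map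
    proof (intro measure_pmf.finite_measure_eq_AE AE_pmfI)
      fix xs assume xs: "xs \<in> set_pmf (random_ordering P)"
      have "set (take N xs) = nth xs ` {..<N}"
        using nth_image[of N xs] perm(1)[OF xs] that by (simp add: lessThan_atLeast0)
      moreover have "card (set (take N xs)) = N"
        using perm[OF xs] that by (simp add: distinct_card)
      ultimately show "xs \<in> (\<lambda>xs. set (take N xs)) -` {B} \<longleftrightarrow> xs \<in> {xs. B \<subseteq> nth xs ` {..<N}}"
        using True card_subset_eq[of "set (take N xs)" B] by auto
    qed auto
    also have "\<dots> = 1 / real (n choose N)"
      using True that assms(1) by (subst prob_random_ordering_covers) (auto simp: n_def)
    finally show ?thesis using True by simp
  next
    case False
    have "B \<notin> set_pmf (R N)"
    proof
      assume "B \<in> set_pmf (R N)"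
      then obtain xs where xs: "xs \<in> set_pmf (random_ordering P)" "B = set (take N xs)"
        by (auto simp: R_def)
      then show False
        using False perm[OF xs(1)] that set_take_subset[of N xs] by (auto simp: distinct_card)
    qed
    then show ?thesis
      using False unfolding set_pmf_iff by auto
  qed
  have "pmf (bind_pmf (map_pmf card D) R) B = (\<integral>N. pmf (R N) B \<partial>map_pmf card D)"
    by (simp add: pmf_bind)
  also have "\<dots> = (\<integral>N. (if B \<subseteq> P then 1 / real (n choose card B) else 0) * indicator {card B} N \<partial>map_pmf card D)"
    by (intro integral_cong_AE AE_pmfI) (auto simp: R Nle indicator_def)
  also have "\<dots> = (if B \<subseteq> P then 1 / real (n choose card B) else 0) * pmf (map_pmf card D) (card B)"
    by (simp add: measure_pmf_single)
  also have "\<dots> = pmf D B"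
  proof (cases "B \<subseteq> P")
    case True
    have "pmf (map_pmf card D) (card B) = measure_pmf.prob D {A. A \<subseteq> P \<and> card A = card B}"
      unfolding pmf_map using sub by (intro measure_pmf.finite_measure_eq_AE AE_pmfI) auto
    also have "\<dots> = (\<Sum>A | A \<subseteq> P \<and> card A = card B. pmf D A)"
      using assms(1) by (intro measure_measure_pmf_finite) auto
    also have "\<dots> = (\<Sum>A | A \<subseteq> P \<and> card A = card B. pmf D B)"
      using True by (intro sum.cong refl exch) auto
    also have "\<dots> = real (n choose card B) * pmf D B"
      using n_subsets[OF assms(1)] by (simp add: n_def)
    finally show ?thesis
      using True card_mono[OF assms(1) True] by (simp add: n_def)
  next
    case False
    then show ?thesis
      using sub by (auto simp: set_pmf_iff)
  qed
  finally show "pmf D B = pmf (bind_pmf (map_pmf card D) (\<lambda>N. map_pmf (\<lambda>xs. set (take N xs)) (random_ordering P))) B"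
    by (simp add: R_def)
qed

section \<open>Percolation from near-rich lines\<close>

lemma perc_step_mono:
  assumes "finite B" "A \<subseteq> B"
  shows "perc_step r P L A \<subseteq> perc_step r P L B"
proof -
  have "card (l \<inter> A) \<le> card (l \<inter> B)" for l
    using assms by (intro card_mono) auto
  then show ?thesis
    using assms(2) order.trans unfolding perc_step_def by blast
qed

lemma perc_step_iterate_bounds:
  assumes "A \<subseteq> P"
  shows "A \<subseteq> (perc_step r P L ^^ k) A \<and> (perc_step r P L ^^ k) A \<subseteq> P"
  using assms by (induction k) (auto simp: perc_step_def)

lemma percolates_mono:
  assumes "finite P" "A \<subseteq> B" "B \<subseteq> P" "percolates r P L A"
  shows "percolates r P L B"
proof -
  obtain k where k: "(perc_step r P L ^^ k) A = P"
    using assms(4) by (auto simp: percolates_def)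
  have "(perc_step r P L ^^ j) A \<subseteq> (perc_step r P L ^^ j) B" for j
  proof (induction j)
    case (Suc j)
    have "finite ((perc_step r P L ^^ j) B)"
      using perc_step_iterate_bounds[OF assms(3)] assms(1) by (meson finite_subset)
    then show ?case
      using Suc by (simp add: perc_step_mono)
  qed (use assms in auto)
  from this[of k] have "(perc_step r P L ^^ k) B = P"
    using k perc_step_iterate_bounds[OF assms(3), where k = k and r = r and L = L] by auto
  then show ?thesis
    by (auto simp: percolates_def)
qed

text \<open>The iterates increase inside a finite set, so one of maximal size is a fixed point, that
  is, a closed set containing \<open>A\<close>. Percolation arguments can then speak of an arbitrary
  closed superset and never count steps.\<close>

lemma percolates_if_closed_eq:
  assumes "finite P" "A \<subseteq> P"
    and closed: "\<And>B. A \<subseteq> B \<Longrightarrow> B \<subseteq> P \<Longrightarrow> (\<And>x l. x \<in> P \<Longrightarrow> l \<in> L \<Longrightarrow> x \<in> l \<Longrightarrow> card (l \<inter> B) \<ge> r \<Longrightarrow> x \<in> B) \<Longrightarrow> B = P"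
  shows "percolates r P L A"
proof -
  define f where "f = (\<lambda>k. (perc_step r P L ^^ k) A)"
  have bounds: "A \<subseteq> f k" "f k \<subseteq> P" for k
    using perc_step_iterate_bounds[OF assms(2)] by (auto simp: f_def)
  have "\<forall>k. card (f k) < Suc (card P)"
    using bounds assms(1) by (simp add: card_mono less_Suc_eq_le)
  then obtain k where k: "\<And>j. card (f j) \<le> card (f k)"
    using ex_has_greatest_nat[of "\<lambda>_. True" 0 "\<lambda>k. card (f k)" "Suc (card P)"] by auto
  have "f k \<subseteq> f (Suc k)"
    by (auto simp: f_def perc_step_def)
  then have "f (Suc k) = f k"
    using k[of "Suc k"] bounds[of "Suc k"] assms(1) by (metis card_seteq finite_subset)
  then have "perc_step r P L (f k) = f k"
    by (simp add: f_def)
  then have "f k = P"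
    using bounds[of k] by (intro closed) (auto simp: perc_step_def)
  then show ?thesis
    by (auto simp: f_def percolates_def)
qed

lemma not_percolates_if_no_rich_line:
  assumes "A \<noteq> P" "\<And>l. l \<in> L \<Longrightarrow> card (l \<inter> A) < r"
  shows "\<not> percolates r P L A"
proof -
  have "perc_step r P L A = A"
    using assms(2) by (fastforce simp: perc_step_def)
  then have "(perc_step r P L ^^ k) A = A" for k
    by (induction k) auto
  then show ?thesis
    using assms(1) by (auto simp: percolates_def)
qed

section \<open>Incidence geometry: how full lines spread over the plane\<close>

context finite_projective_plane
begin

lemma finite_line: "l \<in> L \<Longrightarrow> finite l"
  using line_subset finite_points finite_subset by blast

lemma lines_nonempty: "L \<noteq> {}"
  using card_lines by auto

lemma lines_inter_singleton:
  assumes "l \<in> L" "m \<in> L" "l \<noteq> m"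
  shows "\<exists>x. l \<inter> m = {x}"
proof -
  obtain x where "x \<in> P \<and> x \<in> l \<and> x \<in> m" and "\<forall>y. y \<in> P \<and> y \<in> l \<and> y \<in> m \<longrightarrow> y = x"
    using lines_meet[OF assms] by (rule ex1E)
  then have "l \<inter> m = {x}"
    using line_subset[OF assms(1)] by blast
  then show ?thesis ..
qed

lemma line_avoiding:
  assumes "x \<in> P" "y \<in> P" "x \<noteq> y"
  shows "\<exists>l\<in>L. y \<in> l \<and> x \<notin> l"
proof (rule ccontr)
  assume "\<not> ?thesis"
  then have all: "\<And>l. l \<in> {l \<in> L. y \<in> l} \<Longrightarrow> x \<in> l" by auto
  obtain k where "k \<in> L \<and> x \<in> k \<and> y \<in> k" and k: "\<forall>l. l \<in> L \<and> x \<in> l \<and> y \<in> l \<longrightarrow> l = k"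
    using points_join[OF assms] by (rule ex1E)
  have "{l \<in> L. y \<in> l} \<subseteq> {k}"
    using all k by auto
  then have "card {l \<in> L. y \<in> l} \<le> card {k}"
    by (intro card_mono) auto
  then show False
    using card_lines_through[OF assms(2)] order_ge_2 by simp
qed

text \<open>For \<open>y\<close> other than \<open>x\<close>, a line through \<open>y\<close> that
  avoids \<open>x\<close> meets the lines of \<open>F\<close> in distinct points, since two of them
  share only \<open>x\<close>. It therefore has \<open>r\<close> points of \<open>B\<close>, and
  \<open>y\<close> follows.\<close>

lemma pencil_of_full_lines_fills:
  assumes closed: "\<And>x l. x \<in> P \<Longrightarrow> l \<in> L \<Longrightarrow> x \<in> l \<Longrightarrow> card (l \<inter> B) \<ge> r \<Longrightarrow> x \<in> B"
    and "B \<subseteq> P" "F \<subseteq> L" "card F \<ge> r" "r > 0"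
    and full: "\<And>l. l \<in> F \<Longrightarrow> l \<subseteq> B \<and> x \<in> l"
  shows "B = P"
proof (rule subset_antisym[OF \<open>B \<subseteq> P\<close> subsetI])
  fix y assume "y \<in> P"
  have "F \<noteq> {}"
    using assms(4,5) by auto
  then have "x \<in> B" "x \<in> P"
    using full \<open>B \<subseteq> P\<close> by auto
  show "y \<in> B"
  proof (cases "y = x")
    case False
    then obtain m where m: "m \<in> L" "y \<in> m" "x \<notin> m"
      using line_avoiding[OF \<open>x \<in> P\<close> \<open>y \<in> P\<close>] by auto
    have "\<exists>z. l \<inter> m = {z}" if "l \<in> F" for l
      using lines_inter_singleton[of l m] that full m \<open>F \<subseteq> L\<close> by auto
    then obtain z where z: "\<And>l. l \<in> F \<Longrightarrow> l \<inter> m = {z l}"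
      by metis
    have "inj_on z F"
    proof
      fix l l' assume l: "l \<in> F" "l' \<in> F" "z l = z l'"
      show "l = l'"
      proof (rule ccontr)
        assume "l \<noteq> l'"
        then obtain w where w: "l \<inter> l' = {w}"
          using lines_inter_singleton[of l l'] l \<open>F \<subseteq> L\<close> by auto
        have "x \<in> l \<inter> l'" "z l \<in> l \<inter> l'" "z l \<in> m"
          using full l z[of l] z[of l'] by auto
        then show False
          using w m by auto
      qed
    qed
    have "z ` F \<subseteq> m \<inter> B"
      using z full by blast
    then have "card (z ` F) \<le> card (m \<inter> B)"
      using finite_line[OF m(1)] by (intro card_mono) auto
    then have "r \<le> card (m \<inter> B)"
      using card_image[OF \<open>inj_on z F\<close>] assms(4) by simp
    then show ?thesis
      using closed \<open>y \<in> P\<close> m by blast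
  qed (use \<open>x \<in> B\<close> in simp)
qed

lemma many_full_lines_fill:
  assumes closed: "\<And>x l. x \<in> P \<Longrightarrow> l \<in> L \<Longrightarrow> x \<in> l \<Longrightarrow> card (l \<inter> B) \<ge> r \<Longrightarrow> x \<in> B"
    and "B \<subseteq> P" "F \<subseteq> L" "card F > (r - 1)\<^sup>2" "r > 0"
    and full: "\<And>l. l \<in> F \<Longrightarrow> l \<subseteq> B"
  shows "B = P"
proof (rule ccontr)
  assume "B \<noteq> P"
  then obtain y where y: "y \<in> P" "y \<notin> B"
    using \<open>B \<subseteq> P\<close> by auto
  then obtain m where m: "m \<in> L" "y \<in> m"
    using card_lines_through[OF y(1)] by (metis (mono_tags, lifting) Collect_empty_eq Suc_eq_plus1 card.empty nat.distinct(1))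
  \<comment> \<open>Since \<open>m\<close> contains a point outside \<open>B\<close>, it cannot have
    \<open>r\<close> points of \<open>B\<close>; for the same reason \<open>m\<close> is not in
    \<open>F\<close>, so each line of \<open>F\<close> meets it in one point.\<close>
  have small: "card (m \<inter> B) \<le> r - 1"
    using closed y m \<open>r > 0\<close> by (metis Suc_pred' not_less_eq_eq)
  have "\<exists>z. l \<inter> m = {z}" if "l \<in> F" for l
  proof (rule lines_inter_singleton)
    show "l \<in> L" "m \<in> L" "l \<noteq> m"
      using that full m y \<open>F \<subseteq> L\<close> by auto
  qed
  then obtain z where z: "\<And>l. l \<in> F \<Longrightarrow> l \<inter> m = {z l}"
    by metis
  have "finite F"
    using \<open>F \<subseteq> L\<close> finite_lines finite_subset by blast
  have "z ` F \<subseteq> m \<inter> B"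
    using z full by blast
  moreover have finB: "finite (m \<inter> B)"
    using finite_line[OF m(1)] by auto
  ultimately have img: "card (z ` F) \<le> r - 1" "z ` F \<subseteq> m \<inter> B"
    using small card_mono by (meson order.trans)+
  \<comment> \<open>Pigeonhole: more than \<open>(r - 1)\<^sup>2\<close> lines cross
    \<open>m\<close> in at most \<open>r - 1\<close> points.\<close>
  have "\<exists>x\<in>z ` F. card {l \<in> F. z l = x} \<ge> r"
  proof (rule ccontr)
    assume "\<not> ?thesis"
    then have "\<And>x. x \<in> z ` F \<Longrightarrow> card {l \<in> F. z l = x} \<le> r - 1"
      by fastforce
    then have "(\<Sum>x\<in>z ` F. card {l \<in> F. z l = x}) \<le> card (z ` F) * (r - 1)"
      using sum_bounded_above[of "z ` F" "\<lambda>x. card {l \<in> F. z l = x}" "r - 1"] by simp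
    moreover have "card F = (\<Sum>x\<in>z ` F. card {l \<in> F. z l = x})"
      using sum.group[OF \<open>finite F\<close> finite_imageI[OF \<open>finite F\<close>] subset_refl, of "\<lambda>_. 1::nat" z] by simp
    ultimately have "card F \<le> (r - 1) * (r - 1)"
      using mult_le_mono1[OF img(1), of "r - 1"] by linarith
    then show False
      using assms(4) by (simp add: power2_eq_square)
  qed
  then obtain x where x: "card {l \<in> F. z l = x} \<ge> r"
    by blast
  have "B = P"
  proof (rule pencil_of_full_lines_fills[OF closed \<open>B \<subseteq> P\<close> _ x \<open>r > 0\<close>])
    show "{l \<in> F. z l = x} \<subseteq> L"
      using \<open>F \<subseteq> L\<close> by auto
    show "l \<subseteq> B \<and> x \<in> l" if "l \<in> {l \<in> F. z l = x}" for l
      using that full z by auto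
  qed auto
  then show False
    using \<open>B \<noteq> P\<close> by simp
qed

text \<open>Each \<open>K i\<close> is one point short of filling its line. Once a single line \<open>m\<close> is full, every
  \<open>l i\<close> whose \<open>K i\<close> misses \<open>m\<close> gains the missing point on \<open>m\<close>.\<close>

lemma percolates_if_near_rich_lines:
  assumes "r \<ge> 2" "A \<subseteq> P" "finite J" "card J \<ge> (r - 1)\<^sup>2 + r"
    and l: "\<And>i. i \<in> J \<Longrightarrow> l i \<in> L" and K: "\<And>i. i \<in> J \<Longrightarrow> K i \<subseteq> l i \<inter> Q"
    and cardK: "\<And>i. i \<in> J \<Longrightarrow> card (K i) = r - 1"
    and disj: "\<And>i j. i \<in> J \<Longrightarrow> j \<in> J \<Longrightarrow> i \<noteq> j \<Longrightarrow> K i \<inter> K j = {}"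
    and "Q \<subseteq> A" and poor: "\<And>m. m \<in> L \<Longrightarrow> card (m \<inter> Q) < r"
    and m: "m \<in> L" "card (m \<inter> A) \<ge> r"
  shows "percolates r P L A"
proof (rule percolates_if_closed_eq[OF finite_points \<open>A \<subseteq> P\<close>])
  fix B assume "A \<subseteq> B" "B \<subseteq> P"
    and closed: "\<And>x l. x \<in> P \<Longrightarrow> l \<in> L \<Longrightarrow> x \<in> l \<Longrightarrow> card (l \<inter> B) \<ge> r \<Longrightarrow> x \<in> B"
  have fill: "k \<subseteq> B" if "k \<in> L" "card (k \<inter> B) \<ge> r" for k
    using closed[OF _ that(1) _ that(2)] line_subset[OF that(1)] by blast
  have "card (m \<inter> A) \<le> card (m \<inter> B)"
    using finite_line[OF m(1)] \<open>A \<subseteq> B\<close> by (intro card_mono) auto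
  then have mB: "m \<subseteq> B"
    using m by (intro fill) auto
  \<comment> \<open>The spoiled indices: the intersection of \<open>l i\<close> with
    \<open>m\<close> may already lie in \<open>K i\<close>. As the \<open>K i\<close> are disjoint,
    they inject into \<open>m \<inter> Q\<close>.\<close>
  define J0 where "J0 = {i \<in> J. K i \<inter> m \<noteq> {}}"
  have finK: "finite (K i)" if "i \<in> J" for i
    using cardK[OF that] \<open>r \<ge> 2\<close> by (intro card_ge_0_finite) simp
  have "card J0 \<le> card (m \<inter> Q)"
  proof -
    have "\<forall>i\<in>J0. \<exists>x. x \<in> K i \<inter> m"
      by (auto simp: J0_def)
    then obtain g where g: "\<And>i. i \<in> J0 \<Longrightarrow> g i \<in> K i \<inter> m"
      by metis
    have "inj_on g J0"
    proof (rule inj_onI, rule ccontr)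
      fix i j assume ij: "i \<in> J0" "j \<in> J0" "g i = g j" "i \<noteq> j"
      then have "g i \<in> K i \<inter> K j"
        using g[of i] g[of j] by auto
      then show False
        using disj ij by (auto simp: J0_def)
    qed
    moreover have "g ` J0 \<subseteq> m \<inter> Q"
      using g K by (fastforce simp: J0_def)
    ultimately show ?thesis
      using finite_line[OF m(1)] by (intro card_inj_on_le) auto
  qed
  then have "card J0 \<le> r - 1"
    using poor[OF m(1)] by linarith
  moreover have "card (J - J0) = card J - card J0"
    using \<open>finite J\<close> by (intro card_Diff_subset) (auto simp: J0_def)
  ultimately have big: "card (J - J0) > (r - 1)\<^sup>2"
    using assms(1,4) by linarith
  have full: "l i \<subseteq> B" if "i \<in> J - J0" for i
  proof (rule fill)
    have i: "i \<in> J" "K i \<inter> m = {}" "K i \<subseteq> l i" "K i \<subseteq> B" "card (K i) = r - 1"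
      using that K[of i] cardK[of i] \<open>Q \<subseteq> A\<close> \<open>A \<subseteq> B\<close> by (auto simp: J0_def)
    then have "K i \<noteq> {}"
      using \<open>r \<ge> 2\<close> by auto
    then have "l i \<noteq> m"
      using i by auto
    then obtain x where x: "l i \<inter> m = {x}"
      using lines_inter_singleton l i m by metis
    then have "x \<in> l i \<inter> B" "x \<notin> K i"
      using mB i by auto
    then have "insert x (K i) \<subseteq> l i \<inter> B"
      using i by auto
    then have "card (insert x (K i)) \<le> card (l i \<inter> B)"
      using finite_line[OF l] i by (intro card_mono) auto
    then show "r \<le> card (l i \<inter> B)"
      using i finK \<open>x \<notin> K i\<close> \<open>r \<ge> 2\<close> by simp
  qed (use that l in auto)
  \<comment> \<open>Two indices with the same line would put \<open>2 * (r - 1) \<ge> r\<close>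
    points of \<open>Q\<close> on it, contradicting \<open>poor\<close>.\<close>
  have inj: "inj_on l (J - J0)"
  proof (rule inj_onI, rule ccontr)
    fix i j assume ij: "i \<in> J - J0" "j \<in> J - J0" "l i = l j" "i \<noteq> j"
    have "K i \<union> K j \<subseteq> l i \<inter> Q"
      using ij K[of i] K[of j] by auto
    then have "card (K i \<union> K j) \<le> card (l i \<inter> Q)"
      using finite_line[OF l] ij by (intro card_mono) auto
    moreover have "card (K i \<union> K j) = (r - 1) + (r - 1)"
      using ij disj cardK finK by (subst card_Un_disjoint) auto
    ultimately show False
      using poor[OF l] ij \<open>r \<ge> 2\<close> by fastforce
  qed
  show "B = P"
  proof (rule many_full_lines_fill[OF closed \<open>B \<subseteq> P\<close>])
    show "card (l ` (J - J0)) > (r - 1)\<^sup>2"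
      using big card_image[OF inj] by simp
  qed (use l full \<open>r \<ge> 2\<close> in auto)
qed

text \<open>By \<open>poor\<close> the first line with \<open>r\<close> points appears only after
  all blocks have been read, so the prefix of length \<open>tau_line\<close> contains every
  near-rich set together with a rich line. No earlier prefix can percolate.\<close>

lemma taus_eq_if_near_rich_blocks:
  assumes "r \<ge> 2" "r \<le> q + 1" and xs: "set xs = P"
    and s: "((r - 1)\<^sup>2 + r) * s \<le> length xs" "distinct xs"
    and near: "\<And>i. i < (r - 1)\<^sup>2 + r \<Longrightarrow> \<exists>l\<in>L. \<exists>K. K \<subseteq> l \<and> card K = r - 1 \<and> K \<subseteq> nth xs ` {i * s..<Suc i * s}"
    and poor: "\<And>l. l \<in> L \<Longrightarrow> card (l \<inter> nth xs ` {..<((r - 1)\<^sup>2 + r) * s}) < r"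
  shows "tau_line r L xs = tau_perc r P L xs"
proof -
  define M where "M = (r - 1)\<^sup>2 + r"
  define A0 where "A0 = nth xs ` {..<M * s}"
  have A0: "A0 = set (take (M * s) xs)"
    using nth_image[of "M * s" xs] s(1) by (simp add: A0_def M_def lessThan_atLeast0)
  have rich: "\<exists>l\<in>L. card (l \<inter> set (take (tau_line r L xs) xs)) \<ge> r"
    unfolding tau_line_def
  proof (rule LeastI)
    obtain l where "l \<in> L"
      using lines_nonempty by auto
    moreover have "l \<inter> set xs = l"
      using line_subset xs \<open>l \<in> L\<close> by auto
    ultimately show "\<exists>l\<in>L. card (l \<inter> set (take (length xs) xs)) \<ge> r"
      using card_line[OF \<open>l \<in> L\<close>] \<open>r \<le> q + 1\<close> by (intro bexI[of _ l]) auto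
  qed
  then obtain m where m: "m \<in> L" "card (m \<inter> set (take (tau_line r L xs) xs)) \<ge> r"
    by blast
  have "M * s < tau_line r L xs"
  proof (rule ccontr)
    assume "\<not> ?thesis"
    then have "set (take (tau_line r L xs) xs) \<subseteq> A0"
      unfolding A0 by (intro set_take_subset_set_take) simp
    then have "card (m \<inter> set (take (tau_line r L xs) xs)) \<le> card (m \<inter> A0)"
      using finite_line[OF m(1)] by (intro card_mono) auto
    then show False
      using poor[OF m(1)] m(2) by (simp add: A0_def M_def)
  qed
  obtain l K where lK: "\<And>i. i < M \<Longrightarrow> l i \<in> L" "\<And>i. i < M \<Longrightarrow> K i \<subseteq> l i" "\<And>i. i < M \<Longrightarrow> card (K i) = r - 1"
    "\<And>i. i < M \<Longrightarrow> K i \<subseteq> nth xs ` {i * s..<Suc i * s}"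
    using near unfolding M_def by metis
  have blocks: "{i * s..<Suc i * s} \<subseteq> {..<M * s}" if "i < M" for i
  proof -
    have "Suc i * s \<le> M * s"
      using that by (intro mult_le_mono1) simp
    then show ?thesis by auto
  qed
  have perc: "percolates r P L (set (take (tau_line r L xs) xs))"
  proof (rule percolates_if_near_rich_lines[where J = "{..<M}" and l = l and K = K and Q = A0 and m = m])
    show "K i \<subseteq> l i \<inter> A0" if "i \<in> {..<M}" for i
      using that lK(2,4)[of i] blocks[of i] unfolding A0_def by blast
    show "K i \<inter> K j = {}" if "i \<in> {..<M}" "j \<in> {..<M}" "i \<noteq> j" for i j
    proof -
      have "{i * s..<Suc i * s} \<inter> {j * s..<Suc j * s} = {}"
      proof (cases "i < j")
        case True
        then have "Suc i * s \<le> j * s"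
          using that by (intro mult_le_mono1) simp
        then show ?thesis by auto
      next
        case False
        then have "Suc j * s \<le> i * s"
          using that by (intro mult_le_mono1) simp
        then show ?thesis by auto
      qed
      moreover have "inj_on (nth xs) {..<M * s}"
        using s by (intro inj_on_nth) (auto simp: M_def)
      ultimately have "nth xs ` {i * s..<Suc i * s} \<inter> nth xs ` {j * s..<Suc j * s} = {}"
        using inj_on_image_Int[of "nth xs" "{..<M * s}" "{i * s..<Suc i * s}" "{j * s..<Suc j * s}"]
          blocks that by (metis image_empty lessThan_iff)
      then show ?thesis
        using lK(4)[of i] lK(4)[of j] that by blast
    qed
    show "A0 \<subseteq> set (take (tau_line r L xs) xs)"
      unfolding A0 using \<open>M * s < tau_line r L xs\<close> by (intro set_take_subset_set_take) simp
    show "card (m \<inter> A0) < r" if "m \<in> L" for m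
      using poor[OF that] by (simp add: A0_def M_def)
  qed (use lK m assms set_take_subset[of "tau_line r L xs" xs] in \<open>auto simp: M_def\<close>)
  show ?thesis
    unfolding tau_perc_def
  proof (rule Least_equality[symmetric])
    show "percolates r P L (set (take (tau_line r L xs) xs))"
      by (rule perc)
    \<comment> \<open>A prefix without \<open>r\<close> collinear points is a fixed point of the
      step, and it is not \<open>P\<close> because a whole line has \<open>q + 1 \<ge> r\<close>
      points.\<close>
    fix i assume i: "percolates r P L (set (take i xs))"
    show "tau_line r L xs \<le> i"
    proof (rule ccontr)
      assume "\<not> ?thesis"
      then have no: "\<And>l. l \<in> L \<Longrightarrow> card (l \<inter> set (take i xs)) < r"
        unfolding tau_line_def using not_less_Least[of i "\<lambda>i. \<exists>l\<in>L. r \<le> card (l \<inter> set (take i xs))"]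
        by (meson not_le)
      moreover have "set (take i xs) \<noteq> P"
        using no[OF m(1)] card_line[OF m(1)] line_subset[OF m(1)] \<open>r \<le> q + 1\<close>
        by (auto simp: Int_absorb2)
      ultimately show False
        using not_percolates_if_no_rich_line[of "set (take i xs)"] i by simp
    qed
  qed
qed

end

section \<open>Collinear sets in a block of a random ordering\<close>

text \<open>The probability that \<open>j\<close> given elements of an \<open>n\<close>-set all lie in a uniformly random
  \<open>s\<close>-subset.\<close>

definition cover_prob :: "nat \<Rightarrow> nat \<Rightarrow> nat \<Rightarrow> real" where
  "cover_prob n s j = (\<Prod>i<j. real (s - i) / real (n - i))"

lemma cover_prob_eq:
  assumes "j \<le> n"
  shows "cover_prob n s j = real (s choose j) / real (n choose j)"
proof (cases "j \<le> s")
  case True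
  have "real (s choose j) / real (n choose j)
      = (\<Prod>i<j. real (s - i) / real (j - i)) / (\<Prod>i<j. real (n - i) / real (j - i))"
    using assms True by (simp add: binomial_altdef_of_nat lessThan_atLeast0)
  also have "\<dots> = (\<Prod>i<j. (real (s - i) / real (j - i)) / (real (n - i) / real (j - i)))"
    by (rule prod_dividef[symmetric])
  also have "\<dots> = cover_prob n s j"
    unfolding cover_prob_def by (intro prod.cong) auto
  finally show ?thesis ..
next
  case False
  \<comment> \<open>The factor at \<open>i = s\<close> has numerator \<open>s - s\<close>.\<close>
  then have "cover_prob n s j = 0"
    unfolding cover_prob_def by (intro prod_zero) (auto intro!: bexI[of _ s])
  then show ?thesis
    using False by simp
qed

lemma cover_prob_nonneg: "cover_prob n s j \<ge> 0"
  unfolding cover_prob_def by (intro prod_nonneg) auto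

lemma cover_prob_pos: "j \<le> s \<Longrightarrow> s \<le> n \<Longrightarrow> cover_prob n s j > 0"
  unfolding cover_prob_def by (intro prod_pos) auto

text \<open>Subtracting the same amount from both parts of a fraction that is at most 1 does not
  increase it; beyond \<open>s\<close>, truncated subtraction makes the left side 0.\<close>

lemma diff_ratio_antimono:
  assumes "s \<le> n" "i \<le> j"
  shows "real (s - j) / real (n - j) \<le> real (s - i) / real (n - i)"
proof (cases "j < s")
  case True
  have "real (s - j) / real (n - j) = (real (s - i) - real (j - i)) / (real (n - i) - real (j - i))"
    using True assms by (simp add: of_nat_diff)
  also have "\<dots> \<le> real (s - i) / real (n - i)"
  proof -
    have "(real (s - i) - real (j - i)) * real (n - i) \<le> real (s - i) * (real (n - i) - real (j - i))"
      using mult_right_mono[of "real (s - i)" "real (n - i)" "real (j - i)"] assms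
      by (simp add: algebra_simps)
    moreover have "real (n - i) > 0" "real (n - i) - real (j - i) > 0"
      using True assms by (auto simp: of_nat_diff)
    ultimately show ?thesis
      by (simp add: divide_simps)
  qed
  finally show ?thesis .
qed simp

text \<open>Negative correlation of sampling without replacement: once \<open>j\<close> places of
  the sample are taken, covering \<open>k\<close> further elements is no more likely than
  before.\<close>

lemma cover_prob_add_le:
  assumes "s \<le> n"
  shows "cover_prob n s (j + k) \<le> cover_prob n s j * cover_prob n s k"
proof -
  have "cover_prob n s (j + k) = cover_prob n s j * (\<Prod>i<k. real (s - (j + i)) / real (n - (j + i)))"
    unfolding cover_prob_def by (induction k) (auto simp: mult.assoc)
  also have "(\<Prod>i<k. real (s - (j + i)) / real (n - (j + i))) \<le> cover_prob n s k"
    unfolding cover_prob_def using assms by (intro prod_mono conjI diff_ratio_antimono) auto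
  finally show ?thesis
    using cover_prob_nonneg by (simp add: mult_left_mono)
qed

lemma cover_prob_le_power:
  assumes "s \<le> n"
  shows "cover_prob n s j \<le> (real s / real n) ^ j"
proof -
  have "cover_prob n s j \<le> (\<Prod>i<j. real s / real n)"
    unfolding cover_prob_def using diff_ratio_antimono[OF assms, of 0] by (intro prod_mono) auto
  then show ?thesis by simp
qed

lemma sum_power_card_Diff:
  fixes x :: "'b :: comm_ring_1"
  assumes "finite K"
  shows "(\<Sum>D\<in>Pow K. x ^ card (K - D)) = (1 + x) ^ card K"
  using prod_add[OF assms, of "\<lambda>_. 1" "\<lambda>_. x"] by simp

lemma card_subsets_containing:
  assumes "finite l" "x \<in> l" "k > 0"
  shows "card {K. K \<subseteq> l \<and> card K = k \<and> x \<in> K} = (card l - 1) choose (k - 1)"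
proof -
  have "bij_betw (insert x) {K. K \<subseteq> l - {x} \<and> card K = k - 1} {K. K \<subseteq> l \<and> card K = k \<and> x \<in> K}"
  proof (rule bij_betw_byWitness[where f' = "\<lambda>K. K - {x}"])
    show "insert x ` {K. K \<subseteq> l - {x} \<and> card K = k - 1} \<subseteq> {K. K \<subseteq> l \<and> card K = k \<and> x \<in> K}"
    proof
      fix K' assume "K' \<in> insert x ` {K. K \<subseteq> l - {x} \<and> card K = k - 1}"
      then obtain K where K: "K' = insert x K" "K \<subseteq> l - {x}" "card K = k - 1"
        by auto
      then have "finite K" "x \<notin> K"
        using assms finite_subset by auto
      then show "K' \<in> {K. K \<subseteq> l \<and> card K = k \<and> x \<in> K}"
        using K assms by auto
    qed
  qed (use assms in \<open>auto simp: finite_subset card_Diff_singleton\<close>)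
  then have "card {K. K \<subseteq> l \<and> card K = k \<and> x \<in> K} = card {K. K \<subseteq> l - {x} \<and> card K = k - 1}"
    by (rule bij_betw_same_card[symmetric])
  also have "\<dots> = (card l - 1) choose (k - 1)"
    using n_subsets[of "l - {x}" "k - 1"] assms by (simp add: card_Diff_singleton)
  finally show ?thesis .
qed

text \<open>Split \<open>K'\<close> into \<open>K' \<inter> K\<close>, which ranges over the subsets of \<open>K\<close>, and \<open>K' - K\<close>.\<close>

lemma sum_power_card_Diff_le:
  fixes t :: real
  assumes "finite l" "K \<subseteq> l" "card K = k" "t \<ge> 0"
  shows "(\<Sum>K' | K' \<subseteq> l \<and> card K' = k. t ^ card (K' - K)) \<le> (1 + t * real (card l)) ^ k"
proof -
  have fin: "finite K"
    using assms finite_subset by blast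
  \<comment> \<open>\<open>E\<close> stands for \<open>K' - K\<close> but ranges over all subsets of
    \<open>l\<close> of the right size, including those that meet \<open>K\<close>. The enlarged sum
    factorizes and is still small enough.\<close>
  define S where "S = Sigma (Pow K) (\<lambda>D. {E. E \<subseteq> l \<and> card E = card (K - D)})"
  have "(\<Sum>K' | K' \<subseteq> l \<and> card K' = k. t ^ card (K' - K))
      = (\<Sum>(D, E)\<in>(\<lambda>K'. (K' \<inter> K, K' - K)) ` {K'. K' \<subseteq> l \<and> card K' = k}. t ^ card E)"
    by (subst sum.reindex) (auto simp: inj_on_def)
  also have "\<dots> \<le> (\<Sum>(D, E)\<in>S. t ^ card E)"
  proof (rule sum_mono2)
    show "finite S"
      unfolding S_def using fin assms(1) by auto
    show "(\<lambda>K'. (K' \<inter> K, K' - K)) ` {K'. K' \<subseteq> l \<and> card K' = k} \<subseteq> S"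
    proof clarify
      fix K' assume K': "K' \<subseteq> l" "k = card K'"
      have "finite K'"
        using K' assms finite_subset by blast
      then have "card (K' - K) = card (K - K' \<inter> K)"
        using card_Diff_subset_Int[of K' K] card_Diff_subset_Int[of K "K' \<inter> K"] fin K' assms(3)
        by (simp add: Int_commute)
      then show "(K' \<inter> K, K' - K) \<in> S"
        using K' by (auto simp: S_def)
    qed
  qed (use assms in auto)
  also have "\<dots> = (\<Sum>D\<in>Pow K. \<Sum>E | E \<subseteq> l \<and> card E = card (K - D). t ^ card E)"
    unfolding S_def using fin assms(1) by (subst sum.Sigma) auto
  also have "\<dots> \<le> (\<Sum>D\<in>Pow K. (t * real (card l)) ^ card (K - D))"
  proof (rule sum_mono)
    fix D assume "D \<in> Pow K"
    have "card (K - D) \<le> card l"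
      using assms fin by (intro card_mono) auto
    then have "real (card l choose card (K - D)) \<le> real (card l) ^ card (K - D)"
      using binomial_le_pow of_nat_le_iff by (metis of_nat_power)
    then show "(\<Sum>E | E \<subseteq> l \<and> card E = card (K - D). t ^ card E) \<le> (t * real (card l)) ^ card (K - D)"
      using n_subsets[OF assms(1), of "card (K - D)"] assms(4)
        mult_left_mono[OF \<open>real (card l choose card (K - D)) \<le> _\<close>, of "t ^ card (K - D)"]
      by (simp add: power_mult_distrib mult.commute)
  qed
  also have "\<dots> = (1 + t * real (card l)) ^ k"
    using sum_power_card_Diff[OF fin] assms(3) by simp
  finally show ?thesis .
qed

section \<open>First and second moments of the number of collinear sets\<close>

context finite_projective_plane
begin

lemma q_pos: "real q > 0"
  using order_ge_2 by simp

lemma card_points_pos: "real (card P) > 0"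
  unfolding card_points of_nat_0_less_iff by simp

lemma card_points_le: "real (card P) \<le> 2 * (real q)\<^sup>2" "card P \<le> (q + 1)\<^sup>2"
proof -
  have "2 * real q \<le> real q * real q"
    using order_ge_2 by (intro mult_right_mono) auto
  moreover have "real (card P) = real q * real q + real q + 1" "real q \<ge> 2"
    using order_ge_2 by (simp_all add: card_points power2_eq_square)
  ultimately show "real (card P) \<le> 2 * (real q)\<^sup>2"
    unfolding power2_eq_square by linarith
qed (simp add: card_points power2_eq_square)

lemma line_density_le: "real (q + 1) / real (card P) \<le> 1 / real q"
proof -
  have "real (q + 1) / real (card P) \<le> real (q + 1) / (real (q + 1) * real q)"
    using q_pos card_points_pos
    by (intro divide_left_mono mult_pos_pos) (auto simp: card_points power2_eq_square algebra_simps)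
  then show ?thesis by simp
qed

text \<open>The line takes the place of the sample: this is the fraction of \<open>k\<close>-sets of
  points that lie inside a given line. Exchanging the two roles rewrites
  \<open>((q + 1) choose k) * cover_prob (card P) s k\<close> as
  \<open>cover_prob (card P) (q + 1) k * (s choose k)\<close>, in which \<open>q\<close> and
  \<open>s\<close> are estimated separately.\<close>

lemma cover_prob_line_bounds:
  shows "cover_prob (card P) (q + 1) k \<le> (1 / real q) ^ k"
    and "2 * k \<le> q \<Longrightarrow> (1 / (4 * real q)) ^ k \<le> cover_prob (card P) (q + 1) k"
proof -
  have le: "q + 1 \<le> card P"
    by (simp add: card_points)
  have "(real (q + 1) / real (card P)) ^ k \<le> (1 / real q) ^ k"
    by (intro power_mono line_density_le) auto
  then show "cover_prob (card P) (q + 1) k \<le> (1 / real q) ^ k"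
    using cover_prob_le_power[OF le, of k] by linarith
  assume k: "2 * k \<le> q"
  have "(\<Prod>i<k. 1 / (4 * real q)) \<le> cover_prob (card P) (q + 1) k"
    unfolding cover_prob_def
  proof (intro prod_mono conjI)
    fix i assume "i \<in> {..<k}"
    then have i: "2 * i \<le> q" using k by auto
    have "real (card P - i) \<le> 2 * (real q)\<^sup>2" "card P - i > 0"
      using card_points_le(1) i le by auto
    moreover have "real q / 2 \<le> real (q + 1 - i)"
      using i by (simp add: of_nat_diff)
    ultimately have "(real q / 2) / (2 * (real q)\<^sup>2) \<le> real (q + 1 - i) / real (card P - i)"
      by (intro frac_le) auto
    then show "1 / (4 * real q) \<le> real (q + 1 - i) / real (card P - i)"
      using q_pos by (simp add: power2_eq_square)
  qed auto
  then show "(1 / (4 * real q)) ^ k \<le> cover_prob (card P) (q + 1) k"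
    by simp
qed

lemma card_line_subsets: "l \<in> L \<Longrightarrow> card {K. K \<subseteq> l \<and> card K = k} = (q + 1) choose k"
  using n_subsets[OF finite_line] card_line by simp

text \<open>Union bound over pairs of a line and an \<open>r\<close>-subset of it. The random set
  \<open>f w\<close> is abstract so that it can be a stretch of an ordering or a binomial random
  set. The factor \<open>card P\<close> counts the lines, which are as many as the points.\<close>

lemma prob_rich_line_le:
  fixes M :: "'b pmf" and f :: "'b \<Rightarrow> 'a set"
  assumes "\<And>K. K \<subseteq> P \<Longrightarrow> card K = r \<Longrightarrow> measure_pmf.prob M {w. K \<subseteq> f w} \<le> c"
  shows "measure_pmf.prob M {w. \<exists>l\<in>L. card (l \<inter> f w) \<ge> r} \<le> real (card P) * real ((q + 1) choose r) * c"
proof -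
  define I where "I = Sigma L (\<lambda>l. {K. K \<subseteq> l \<and> card K = r})"
  have fin: "finite I"
    unfolding I_def using finite_lines finite_line by auto
  have cardI: "card I = card P * ((q + 1) choose r)"
    unfolding I_def using finite_lines finite_line
    by (subst card_SigmaI) (auto simp: card_line_subsets card_lines card_points)
  have "{w. \<exists>l\<in>L. card (l \<inter> f w) \<ge> r} \<subseteq> (\<Union>(l, K)\<in>I. {w. K \<subseteq> f w})"
  proof clarify
    fix w l assume "l \<in> L" "r \<le> card (l \<inter> f w)"
    then obtain K where "K \<subseteq> l \<inter> f w" "card K = r"
      using finite_line by (meson obtain_subset_with_card_n)
    then show "w \<in> (\<Union>(l, K)\<in>I. {w. K \<subseteq> f w})"
      using \<open>l \<in> L\<close> by (auto simp: I_def)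
  qed
  then have "measure_pmf.prob M {w. \<exists>l\<in>L. card (l \<inter> f w) \<ge> r}
      \<le> measure_pmf.prob M (\<Union>(l, K)\<in>I. {w. K \<subseteq> f w})"
    by (intro measure_pmf.finite_measure_mono) auto
  also have "\<dots> \<le> (\<Sum>(l, K)\<in>I. measure_pmf.prob M {w. K \<subseteq> f w})"
    using measure_pmf.finite_measure_subadditive_finite[OF fin, of "\<lambda>(l, K). {w. K \<subseteq> f w}" M]
    by (simp add: case_prod_unfold)
  also have "\<dots> \<le> (\<Sum>(l, K)\<in>I. c)"
    using line_subset by (intro sum_mono) (auto simp: I_def intro!: assms)
  also have "\<dots> = real (card P) * real ((q + 1) choose r) * c"
    by (simp add: case_prod_unfold cardI)
  finally show ?thesis .
qed

lemma prob_random_ordering_rich_line_le: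
  assumes "I \<subseteq> {..<card P}" "r \<le> q + 1"
  shows "measure_pmf.prob (random_ordering P) {xs. \<exists>l\<in>L. card (l \<inter> nth xs ` I) \<ge> r}
    \<le> 2 * (real q)\<^sup>2 * (real (card I) / real q) ^ r"
proof -
  have rn: "r \<le> card P"
    using assms(2) by (simp add: card_points)
  have "measure_pmf.prob (random_ordering P) {xs. \<exists>l\<in>L. card (l \<inter> nth xs ` I) \<ge> r}
      \<le> real (card P) * real ((q + 1) choose r) * (real (card I choose r) / real (card P choose r))"
    using prob_random_ordering_covers[OF finite_points assms(1)] by (intro prob_rich_line_le) auto
  \<comment> \<open>The roles of line and sample are exchanged here.\<close>
  also have "\<dots> = real (card P) * (cover_prob (card P) (q + 1) r * real (card I choose r))"
    by (simp add: cover_prob_eq[OF rn])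
  also have "\<dots> \<le> (2 * (real q)\<^sup>2) * ((1 / real q) ^ r * real (card I) ^ r)"
  proof (intro mult_mono card_points_le cover_prob_line_bounds)
    show "real (card I choose r) \<le> real (card I) ^ r"
    proof (cases "r \<le> card I")
      case True
      then show ?thesis
        using binomial_le_pow of_nat_le_iff by (metis of_nat_power)
    qed (simp add: binomial_eq_0)
  qed (auto simp: cover_prob_nonneg)
  also have "\<dots> = 2 * (real q)\<^sup>2 * (real (card I) / real q) ^ r"
    by (simp add: power_divide)
  finally show ?thesis .
qed

lemma prob_random_points_rich_line_le:
  assumes "0 \<le> p" "p \<le> 1" "r \<le> q + 1"
  shows "measure_pmf.prob (random_points P p) {A. \<exists>l\<in>L. card (l \<inter> A) \<ge> r}
    \<le> 2 * (real q)\<^sup>2 * (2 * real q * p) ^ r"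
proof -
  have "measure_pmf.prob (random_points P p) {A. \<exists>l\<in>L. card (l \<inter> A) \<ge> r}
      \<le> real (card P) * real ((q + 1) choose r) * p ^ r"
    using prob_random_points_covers[OF finite_points _ assms(1,2)] by (intro prob_rich_line_le) auto
  also have "\<dots> \<le> (2 * (real q)\<^sup>2) * (2 * real q) ^ r * p ^ r"
  proof (intro mult_right_mono mult_mono card_points_le)
    have "real ((q + 1) choose r) \<le> real (q + 1) ^ r"
      using binomial_le_pow[OF assms(3)] of_nat_le_iff by (metis of_nat_power)
    also have "\<dots> \<le> (2 * real q) ^ r"
      using order_ge_2 by (intro power_mono) auto
    finally show "real ((q + 1) choose r) \<le> (2 * real q) ^ r" .
  qed (use assms in auto)
  finally show ?thesis
    by (simp add: power_mult_distrib mult.assoc)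
qed

text \<open>On one line \<open>K\<close> and \<open>K'\<close> may overlap arbitrarily. Each point
  of \<open>K' - K\<close> costs a factor \<open>s / card P\<close>, and there are at most
  \<open>q + 1\<close> choices for it; \<open>s / q\<close> bounds the expected number of sample
  points on the line.\<close>

lemma sum_cover_prob_same_line_le:
  assumes "l \<in> L" "K \<subseteq> l" "card K = k" "s \<le> card P"
  shows "(\<Sum>K' | K' \<subseteq> l \<and> card K' = k. cover_prob (card P) s (card (K \<union> K')))
    \<le> cover_prob (card P) s k * (1 + real s / real q) ^ k"
proof -
  define t where "t = real s / real (card P)"
  have fin: "finite l" "finite K"
    using finite_line assms finite_subset by blast+
  have "(\<Sum>K' | K' \<subseteq> l \<and> card K' = k. cover_prob (card P) s (card (K \<union> K')))
     \<le> (\<Sum>K' | K' \<subseteq> l \<and> card K' = k. cover_prob (card P) s k * t ^ card (K' - K))"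
  proof (rule sum_mono, clarify)
    fix K' assume K': "K' \<subseteq> l" "k = card K'"
    have "finite K'"
      using K' fin finite_subset by blast
    then have "card (K \<union> K') = k + card (K' - K)"
      using card_Un_disjoint[of K "K' - K"] fin assms(3) by (simp add: K'(2))
    then have "cover_prob (card P) s (card (K \<union> K')) \<le> cover_prob (card P) s k * cover_prob (card P) s (card (K' - K))"
      using cover_prob_add_le[OF assms(4)] by simp
    also have "\<dots> \<le> cover_prob (card P) s k * t ^ card (K' - K)"
      unfolding t_def by (intro mult_left_mono cover_prob_le_power assms cover_prob_nonneg)
    finally show "cover_prob (card P) s (card (K \<union> K')) \<le> cover_prob (card P) s (card K') * t ^ card (K' - K)"
      by (simp add: K')
  qed
  also have "\<dots> = cover_prob (card P) s k * (\<Sum>K' | K' \<subseteq> l \<and> card K' = k. t ^ card (K' - K))"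
    by (simp add: sum_distrib_left)
  also have "\<dots> \<le> cover_prob (card P) s k * (1 + t * real (card l)) ^ k"
    by (intro mult_left_mono sum_power_card_Diff_le fin assms cover_prob_nonneg) (simp add: t_def)
  also have "\<dots> \<le> cover_prob (card P) s k * (1 + real s / real q) ^ k"
  proof (intro mult_left_mono power_mono cover_prob_nonneg)
    have "real s * (real (q + 1) / real (card P)) \<le> real s * (1 / real q)"
      by (intro mult_left_mono line_density_le) auto
    then show "1 + t * real (card l) \<le> 1 + real s / real q"
      using card_line[OF assms(1)] by (simp add: t_def)
  qed (simp add: t_def)
  finally show ?thesis .
qed

text \<open>Sets on two lines can share only the intersection point \<open>x\<close>. Unless both
  contain it, they are disjoint and contribute at most the product of the means; if both do, the
  union has \<open>2 * k - 1\<close> points, which gives the second term.\<close>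

lemma sum_cover_prob_two_lines_le:
  assumes "l \<in> L" "l' \<in> L" "l \<noteq> l'" "s \<le> card P" "k > 0"
  shows "(\<Sum>K | K \<subseteq> l \<and> card K = k. \<Sum>K' | K' \<subseteq> l' \<and> card K' = k. cover_prob (card P) s (card (K \<union> K')))
    \<le> (real ((q + 1) choose k) * cover_prob (card P) s k)\<^sup>2
       + (real (q choose (k - 1)))\<^sup>2 * (cover_prob (card P) s k * cover_prob (card P) s (k - 1))"
proof -
  obtain x where x: "l \<inter> l' = {x}"
    using lines_inter_singleton assms by blast
  define a where "a = cover_prob (card P) s"
  have a0: "a j \<ge> 0" for j
    by (simp add: a_def cover_prob_nonneg)
  have fin: "finite l" "finite l'"
    using finite_line assms by auto
  define A where "A = (\<lambda>l :: 'a set. {K. K \<subseteq> l \<and> card K = k})"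
  have finA: "finite (A l)" "finite (A l')"
    using fin by (auto simp: A_def)
  have cardA: "card (A l) = (q + 1) choose k" "card (A l') = (q + 1) choose k"
    using card_line_subsets assms by (auto simp: A_def)
  have cardAx: "card {K \<in> A l. x \<in> K} = q choose (k - 1)" "card {K \<in> A l'. x \<in> K} = q choose (k - 1)"
    using card_subsets_containing[OF fin(1) _ \<open>k > 0\<close>, of x] card_subsets_containing[OF fin(2) _ \<open>k > 0\<close>, of x]
      x card_line assms by (auto simp: A_def conj_assoc)
  have "a (card (K \<union> K')) \<le> a k * a k + (if x \<in> K then 1 else 0) * (if x \<in> K' then 1 else 0) * (a k * a (k - 1))"
    if "K \<in> A l" "K' \<in> A l'" for K K'
  proof -
    have K: "K \<subseteq> l" "card K = k" "K' \<subseteq> l'" "card K' = k" "finite K" "finite K'"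
      using that fin finite_subset by (auto simp: A_def)
    have Un: "card (K \<union> K') + card (K \<inter> K') = k + k"
      using card_Un_Int[of K K'] K by simp
    show ?thesis
    proof (cases "x \<in> K \<and> x \<in> K'")
      case True
      then have "K \<inter> K' = {x}"
        using x K by auto
      then have "card (K \<union> K') = k + (k - 1)"
        using Un \<open>k > 0\<close> by simp
      then show ?thesis
        using cover_prob_add_le[OF assms(4), of k "k - 1"] True a0 by (simp add: a_def add_increasing)
    next
      case False
      then have "K \<inter> K' = {}"
        using x K by auto
      then have "card (K \<union> K') = k + k"
        using Un by simp
      then show ?thesis
        using cover_prob_add_le[OF assms(4), of k k] False by (auto simp: a_def)
    qed
  qed
  then have "(\<Sum>K\<in>A l. \<Sum>K'\<in>A l'. a (card (K \<union> K')))
     \<le> (\<Sum>K\<in>A l. \<Sum>K'\<in>A l'. a k * a k + (if x \<in> K then 1 else 0) * (if x \<in> K' then 1 else 0) * (a k * a (k - 1)))"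
    by (intro sum_mono) auto
  also have "\<dots> = real (card (A l)) * real (card (A l')) * (a k * a k)
      + (\<Sum>K\<in>A l. if x \<in> K then 1 else 0) * (\<Sum>K'\<in>A l'. if x \<in> K' then 1 else 0) * (a k * a (k - 1))"
    by (simp add: sum.distrib sum_product sum_distrib_right sum_distrib_left mult.assoc) (rule sum.swap)
  also have "\<dots> = (real ((q + 1) choose k) * a k)\<^sup>2 + (real (q choose (k - 1)))\<^sup>2 * (a k * a (k - 1))"
    using finA by (simp add: cardA cardAx sum.If_cases Int_def power2_eq_square)
  finally show ?thesis
    by (simp add: A_def a_def)
qed

text \<open>Variance over squared mean for the number of collinear \<open>k\<close>-sets. The first
  term comes from pairs on different lines through a common point, the second from pairs on the same
  line. Both vanish when \<open>s\<close> tends to infinity faster than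
  \<open>q powr (1 - 2 / k)\<close> and is itself unbounded.\<close>

lemma prob_no_near_rich_line_le:
  assumes I: "I \<subseteq> {..<card P}" "card I = s" and "k > 0" "2 * k \<le> s" "2 * k \<le> q"
  shows "measure_pmf.prob (random_ordering P) {xs. \<forall>l\<in>L. card (l \<inter> nth xs ` I) < k}
    \<le> 2 * (real k)\<^sup>2 / real s + (4 * real k * (1 + real q / real s)) ^ k / (real q)\<^sup>2"
proof -
  define n where "n = card P"
  define a where "a = cover_prob n s"
  define C where "C = real ((q + 1) choose k)"
  define c where "c = real (q choose (k - 1))"
  define A where "A = (\<lambda>l :: 'a set. {K. K \<subseteq> l \<and> card K = k})"
  define T where "T = Sigma L A"
  define E where "E = (\<lambda>i :: 'a set \<times> 'a set. {xs. snd i \<subseteq> nth xs ` I})"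
  \<comment> \<open>The expected number of \<open>k\<close>-subsets of one given line among the
    entries at \<open>I\<close>. There are \<open>n\<close> lines, so the total mean is
    \<open>n * m\<close>.\<close>
  define m where "m = C * a k"
  define Y where "Y = (1 + real s / real q) ^ k"
  define V where "V = c\<^sup>2 * (a k * a (k - 1))"
  define M where "M = random_ordering P"
  have sn: "s \<le> n"
    using I card_mono[OF _ I(1)] by (simp add: n_def)
  have kn: "2 * k \<le> n"
    using assms(4) sn by simp
  have n_pos: "real n > 0"
    using card_points_pos by (simp add: n_def)
  have s_pos: "real s > 0"
    using assms by simp
  have C_pos: "C > 0"
    using assms by (simp add: C_def)
  have a_pos: "a k > 0" "a (k - 1) > 0"
    using assms sn by (auto simp: a_def intro!: cover_prob_pos)
  have m_pos: "m > 0"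
    using C_pos a_pos by (simp add: m_def)
  have V_nonneg: "V \<ge> 0"
    using a_pos by (simp add: V_def)
  have finA: "finite (A l)" if "l \<in> L" for l
    using finite_line[OF that] by (simp add: A_def)
  have cardA: "card (A l) = (q + 1) choose k" if "l \<in> L" for l
    using card_line_subsets[OF that] by (simp add: A_def)
  have finT: "finite T"
    unfolding T_def using finite_lines finA by auto
  have cardT: "real (card T) = real n * C"
    unfolding T_def using finite_lines finA
    by (subst card_SigmaI) (auto simp: cardA card_lines n_def card_points C_def algebra_simps)
  have sub: "K \<subseteq> P" "card K = k" "finite K" if "l \<in> L" "K \<in> A l" for l K
    using that line_subset finite_line finite_subset by (fastforce simp: A_def)+
  have prob_cov: "measure_pmf.prob M {xs. B \<subseteq> nth xs ` I} = a (card B)" if "B \<subseteq> P" for B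
    using prob_random_ordering_covers[OF finite_points I(1) that] cover_prob_eq[of "card B" n s]
      card_mono[OF finite_points that] I(2) by (simp add: M_def a_def n_def)
  have prob_E: "measure_pmf.prob M (E i) = a k" if "i \<in> T" for i
    using that sub prob_cov[of "snd i"] by (auto simp: T_def E_def)
  have mean: "(\<Sum>i\<in>T. measure_pmf.prob M (E i)) = real n * m"
    by (simp add: prob_E cardT m_def)
  have prob_EE: "measure_pmf.prob M (E (l, K) \<inter> E (l', K')) = a (card (K \<union> K'))"
    if "l \<in> L" "K \<in> A l" "l' \<in> L" "K' \<in> A l'" for l K l' K'
  proof -
    have "E (l, K) \<inter> E (l', K') = {xs. K \<union> K' \<subseteq> nth xs ` I}"
      by (auto simp: E_def)
    then show ?thesis
      using prob_cov[of "K \<union> K'"] sub that by simp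
  qed
  have sum_T: "(\<Sum>i\<in>T. g i) = (\<Sum>l\<in>L. \<Sum>K\<in>A l. g (l, K))" for g :: "'a set \<times> 'a set \<Rightarrow> real"
    unfolding T_def using finite_lines finA by (subst sum.Sigma) (auto simp: case_prod_unfold)
  have "(\<Sum>i\<in>T. \<Sum>j\<in>T. measure_pmf.prob M (E i \<inter> E j))
      = (\<Sum>l\<in>L. \<Sum>K\<in>A l. \<Sum>l'\<in>L. \<Sum>K'\<in>A l'. measure_pmf.prob M (E (l, K) \<inter> E (l', K')))"
    by (simp only: sum_T)
  also have "\<dots> = (\<Sum>l\<in>L. \<Sum>K\<in>A l. \<Sum>l'\<in>L. \<Sum>K'\<in>A l'. a (card (K \<union> K')))"
    by (intro sum.cong refl prob_EE)
  also have "\<dots> = (\<Sum>l\<in>L. \<Sum>l'\<in>L. \<Sum>K\<in>A l. \<Sum>K'\<in>A l'. a (card (K \<union> K')))"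
    by (intro sum.cong refl sum.swap)
  \<comment> \<open>With \<open>m\<^sup>2 + V\<close> granted to every pair of lines, the total
    contains exactly \<open>(n * m)\<^sup>2\<close>, which cancels against the squared mean.\<close>
  also have "\<dots> \<le> (\<Sum>l\<in>L. \<Sum>l'\<in>L. (if l' = l then m * Y else 0) + (m\<^sup>2 + V))"
  proof (intro sum_mono)
    fix l l' assume l: "l \<in> L" "l' \<in> L"
    show "(\<Sum>K\<in>A l. \<Sum>K'\<in>A l'. a (card (K \<union> K'))) \<le> (if l' = l then m * Y else 0) + (m\<^sup>2 + V)"
    proof (cases "l' = l")
      case True
      have "(\<Sum>K\<in>A l. \<Sum>K'\<in>A l'. a (card (K \<union> K'))) \<le> (\<Sum>K\<in>A l. a k * Y)"
        using sum_cover_prob_same_line_le[OF l(1) _ _ sn[unfolded n_def]] True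
        by (intro sum_mono) (auto simp: A_def a_def Y_def n_def)
      also have "\<dots> = m * Y"
        by (simp add: cardA l m_def C_def)
      finally show ?thesis
        using True V_nonneg by (simp add: add_increasing2)
    next
      case False
      then show ?thesis
        using sum_cover_prob_two_lines_le[OF l _ sn[unfolded n_def] \<open>k > 0\<close>]
        by (simp add: A_def a_def m_def V_def C_def c_def n_def)
    qed
  qed
  also have "\<dots> = real n * (m * Y) + (real n)\<^sup>2 * (m\<^sup>2 + V)"
  proof -
    have "card L = n"
      by (simp add: n_def card_lines card_points)
    then show ?thesis
      using finite_lines by (simp add: sum.distrib power2_eq_square distrib_left mult.assoc)
  qed
  finally have E2: "(\<Sum>i\<in>T. \<Sum>j\<in>T. measure_pmf.prob M (E i \<inter> E j))
      \<le> real n * (m * Y) + (real n)\<^sup>2 * (m\<^sup>2 + V)" .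
  have "measure_pmf.prob M {xs. \<forall>l\<in>L. card (l \<inter> nth xs ` I) < k}
      \<le> measure_pmf.prob M {xs. (\<Sum>i\<in>T. indicator (E i) xs) \<le> (0 :: real)}"
  proof (intro measure_pmf.finite_measure_mono subsetI)
    fix xs assume xs: "xs \<in> {xs. \<forall>l\<in>L. card (l \<inter> nth xs ` I) < k}"
    have "xs \<notin> E i" if "i \<in> T" for i
    proof
      assume "xs \<in> E i"
      then have "snd i \<subseteq> fst i \<inter> nth xs ` I" "fst i \<in> L" "card (snd i) = k"
        using that by (auto simp: T_def A_def E_def)
      then have "k \<le> card (fst i \<inter> nth xs ` I)"
        using finite_line card_mono by (metis finite_Int)
      then show False
        using xs \<open>fst i \<in> L\<close> by auto
    qed
    then show "xs \<in> {xs. (\<Sum>i\<in>T. indicator (E i) xs) \<le> (0 :: real)}"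
      by simp
  qed auto
  also have "\<dots> \<le> ((\<Sum>i\<in>T. \<Sum>j\<in>T. measure_pmf.prob M (E i \<inter> E j)) - (real n * m)\<^sup>2) / (real n * m - 0)\<^sup>2"
    unfolding mean[symmetric] using n_pos m_pos by (intro second_moment_bound finT) (simp add: mean)
  also have "\<dots> \<le> (real n * (m * Y) + (real n)\<^sup>2 * V) / (real n * m)\<^sup>2"
    using E2 unfolding diff_zero by (intro divide_right_mono) (auto simp: algebra_simps power_mult_distrib)
  also have "\<dots> = Y / (real n * m) + V / m\<^sup>2"
    using n_pos m_pos by (simp add: add_divide_distrib power2_eq_square)
  \<comment> \<open>Absorption gives \<open>c / C = k / (q + 1)\<close>, and
    \<open>a (k - 1) / a k\<close> is the inverse of the last factor of \<open>a k\<close>. Then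
    \<open>n \<le> (q + 1)\<^sup>2\<close> cancels \<open>q\<close>, and
    \<open>s - (k - 1) \<ge> s / 2\<close> gives the 2.\<close>
  also have "V / m\<^sup>2 \<le> 2 * (real k)\<^sup>2 / real s"
  proof -
    have "a k = a (k - 1) * (real (s - (k - 1)) / real (n - (k - 1)))"
      using \<open>k > 0\<close> unfolding a_def cover_prob_def by (cases k) auto
    moreover have "real (q + 1) * c = real k * C"
      using binomial_absorption[of "k - 1" "q + 1"] \<open>k > 0\<close> unfolding c_def C_def
      by (simp del: of_nat_add of_nat_Suc flip: of_nat_mult)
    then have "c = real k * C / real (q + 1)"
      by (simp add: field_simps)
    ultimately have "V / m\<^sup>2 = (real k)\<^sup>2 / (real (q + 1))\<^sup>2 * (real (n - (k - 1)) / real (s - (k - 1)))"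
      using C_pos a_pos \<open>2 * k \<le> s\<close> kn
      by (simp add: V_def m_def power_mult_distrib power_divide power2_eq_square mult.assoc del: of_nat_add of_nat_diff)
    also have "\<dots> \<le> (real k)\<^sup>2 / (real (q + 1))\<^sup>2 * ((real (q + 1))\<^sup>2 / (real s / 2))"
    proof (intro mult_left_mono frac_le)
      have "real n \<le> (real (q + 1))\<^sup>2"
        using card_points_le(2) unfolding n_def by (metis of_nat_le_iff of_nat_power)
      then show "real (n - (k - 1)) \<le> (real (q + 1))\<^sup>2"
        by linarith
      show "real s / 2 \<le> real (s - (k - 1))"
        using \<open>2 * k \<le> s\<close> \<open>k > 0\<close> by linarith
    qed (use s_pos in auto)
    also have "\<dots> = 2 * (real k)\<^sup>2 / real s"
      by (simp add: field_simps)
    finally show ?thesis .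
  qed
  also have "Y / (real n * m) \<le> (4 * real k * (1 + real q / real s)) ^ k / (real q)\<^sup>2"
  proof -
    have "k \<le> n"
      using kn by simp
    \<comment> \<open>Lower bound for \<open>m\<close> after exchanging line and sample, with
      \<open>(s choose k) \<ge> (s / k) ^ k\<close>.\<close>
    have "(1 / (4 * real q)) ^ k * (real s / real k) ^ k \<le> cover_prob n (q + 1) k * real (s choose k)"
      using cover_prob_line_bounds(2)[OF \<open>2 * k \<le> q\<close>] binomial_ge_n_over_k_pow_k[of k s, where 'a = real] assms
      by (intro mult_mono) (auto simp: n_def cover_prob_nonneg)
    also have "\<dots> = m"
      using cover_prob_eq[OF \<open>k \<le> n\<close>] by (simp add: m_def C_def a_def)
    finally have m_ge: "(real s / (4 * real k * real q)) ^ k \<le> m"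
      by (simp add: power_mult_distrib[symmetric] mult_ac)
    have "(real q)\<^sup>2 \<le> real n"
      by (simp add: n_def card_points)
    then have "Y / (real n * m) \<le> Y / ((real q)\<^sup>2 * (real s / (4 * real k * real q)) ^ k)"
      using m_ge q_pos s_pos n_pos m_pos \<open>k > 0\<close>
      by (intro divide_left_mono mult_mono mult_pos_pos zero_less_power) (auto simp: Y_def)
    also have "\<dots> = ((1 + real s / real q) / (real s / (4 * real k * real q))) ^ k / (real q)\<^sup>2"
      by (simp add: Y_def power_divide power_mult_distrib mult.commute)
    also have "(1 + real s / real q) / (real s / (4 * real k * real q)) = 4 * real k * (1 + real q / real s)"
      using q_pos s_pos \<open>k > 0\<close> by (simp add: field_simps)
    finally show ?thesis .
  qed
  finally show ?thesis
    by (simp add: M_def)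
qed

end

section \<open>Percolation probabilities\<close>

lemma prob_bind_pmf:
  "measure_pmf.prob (bind_pmf M f) S = measure_pmf.expectation M (\<lambda>x. measure_pmf.prob (f x) S)"
proof -
  have int: "integrable (measure_pmf M) (\<lambda>x. measure_pmf.prob (f x) S)"
    by (rule measure_pmf.integrable_const_bound[where B = 1]) auto
  have "ennreal (measure_pmf.prob (bind_pmf M f) S) = (\<integral>\<^sup>+x. ennreal (measure_pmf.prob (f x) S) \<partial>measure_pmf M)"
    by (simp add: measure_pmf.emeasure_eq_measure[symmetric])
  also have "\<dots> = ennreal (measure_pmf.expectation M (\<lambda>x. measure_pmf.prob (f x) S))"
    by (rule nn_integral_eq_integral[OF int]) simp
  finally show ?thesis
    by (subst (asm) ennreal_inj) (auto intro: integral_nonneg)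
qed

text \<open>Chebyshev at half the mean \<open>n * p\<close>: the variance is at most
  \<open>n * p\<close> and the distance is \<open>n * p / 2\<close>.\<close>

lemma prob_random_points_card_less:
  fixes P :: "'a set"
  assumes "finite P" "0 < p" "p \<le> 1" "real s \<le> real (card P) * p / 2" "card P > 0"
  shows "measure_pmf.prob (random_points P p) {A. card A < s} \<le> 4 / (real (card P) * p)"
proof -
  define M where "M = random_points P p"
  define n where "n = real (card P)"
  define E where "E = (\<lambda>x :: 'a. {A. x \<in> A})"
  have np: "n * p > 0"
    using assms by (simp add: n_def)
  have E: "measure_pmf.prob M (E x) = p" if "x \<in> P" for x
    using prob_random_points_covers[OF assms(1), of "{x}" p] that assms by (simp add: M_def E_def)
  have EE: "measure_pmf.prob M (E x \<inter> E y) = (if x = y then p - p\<^sup>2 else 0) + p\<^sup>2" if "x \<in> P" "y \<in> P" for x y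
  proof -
    have "E x \<inter> E y = {A. {x, y} \<subseteq> A}"
      by (auto simp: E_def)
    then have "measure_pmf.prob M (E x \<inter> E y) = p ^ card {x, y}"
      using prob_random_points_covers[OF assms(1), of "{x, y}" p] that assms by (simp add: M_def)
    then show ?thesis
      by (auto simp: power2_eq_square)
  qed
  have mean: "(\<Sum>x\<in>P. measure_pmf.prob M (E x)) = n * p"
    by (simp add: E n_def)
  have sq: "(\<Sum>x\<in>P. \<Sum>y\<in>P. measure_pmf.prob M (E x \<inter> E y)) = n * (p - p\<^sup>2) + n\<^sup>2 * p\<^sup>2"
    using assms(1) by (simp add: EE sum.distrib n_def power2_eq_square algebra_simps)
  have "measure_pmf.prob M {A. card A < s} \<le> measure_pmf.prob M {A. (\<Sum>x\<in>P. indicator (E x) A) \<le> n * p / 2}"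
  proof (intro measure_pmf.finite_measure_mono_AE AE_pmfI impI)
    fix A assume A: "A \<in> set_pmf M" "A \<in> {A. card A < s}"
    have "A \<subseteq> P"
      using set_pmf_random_points[OF assms(1)] A by (simp add: M_def)
    then have "(\<Sum>x\<in>P. indicator (E x) A) = real (card A)"
      using assms(1) by (simp add: E_def indicator_def sum.If_cases Int_absorb1)
    then show "A \<in> {A. (\<Sum>x\<in>P. indicator (E x) A) \<le> n * p / 2}"
      using A assms(4) by (simp add: n_def)
  qed auto
  also have "\<dots> \<le> (n * (p - p\<^sup>2) + n\<^sup>2 * p\<^sup>2 - (n * p)\<^sup>2) / (n * p - n * p / 2)\<^sup>2"
    unfolding sq[symmetric] mean[symmetric] using np
    by (intro second_moment_bound assms(1)) (simp add: mean)
  also have "\<dots> = n * (p - p\<^sup>2) / (n * p / 2)\<^sup>2"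
    by (simp add: power_mult_distrib)
  also have "\<dots> \<le> n * p / (n * p / 2)\<^sup>2"
    by (intro divide_right_mono mult_left_mono) (auto simp: n_def)
  also have "\<dots> = 4 / (n * p)"
    using np by (simp add: power2_eq_square field_simps)
  finally show ?thesis
    by (simp add: M_def n_def)
qed

context finite_projective_plane
begin

text \<open>Either one of the \<open>J\<close> blocks has no \<open>r - 1\<close> collinear points
  or their union has \<open>r\<close> collinear ones. All blocks share one bound, because only the
  number of positions matters.\<close>

lemma prob_taus_differ_le:
  assumes "r \<ge> 2" "2 * (r - 1) \<le> s" "2 * (r - 1) \<le> q" and J: "J = (r - 1)\<^sup>2 + r" "J * s \<le> card P"
  shows "measure_pmf.prob (random_ordering P) {xs. tau_line r L xs \<noteq> tau_perc r P L xs}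
    \<le> real J * (2 * (real (r - 1))\<^sup>2 / real s + (4 * real (r - 1) * (1 + real q / real s)) ^ (r - 1) / (real q)\<^sup>2)
      + 2 * (real q)\<^sup>2 * (real (J * s) / real q) ^ r"
proof -
  define M where "M = random_ordering P"
  define b where "b = 2 * (real (r - 1))\<^sup>2 / real s + (4 * real (r - 1) * (1 + real q / real s)) ^ (r - 1) / (real q)\<^sup>2"
  define U where "U = (\<lambda>i. {xs. \<forall>l\<in>L. card (l \<inter> nth xs ` {i * s..<Suc i * s}) < r - 1})"
  define W where "W = {xs. \<exists>l\<in>L. card (l \<inter> nth xs ` {..<J * s}) \<ge> r}"
  have rq: "r \<le> q + 1"
    using assms by linarith
  have "measure_pmf.prob M {xs. tau_line r L xs \<noteq> tau_perc r P L xs} \<le> measure_pmf.prob M ((\<Union>i<J. U i) \<union> W)"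
  proof (intro measure_pmf.finite_measure_mono_AE AE_pmfI impI)
    fix xs assume xs: "xs \<in> set_pmf M" "xs \<in> {xs. tau_line r L xs \<noteq> tau_perc r P L xs}"
    have perm: "set xs = P" "distinct xs" "length xs = card P"
      using xs finite_points
      by (auto simp: M_def random_ordering_def length_finite_permutations_of_set permutations_of_setD)
    show "xs \<in> (\<Union>i<J. U i) \<union> W"
    proof (rule ccontr)
      assume not: "xs \<notin> (\<Union>i<J. U i) \<union> W"
      have "tau_line r L xs = tau_perc r P L xs"
      proof (rule taus_eq_if_near_rich_blocks[OF \<open>r \<ge> 2\<close> rq perm(1) _ perm(2)])
        show "((r - 1)\<^sup>2 + r) * s \<le> length xs"
          using J perm by simp
        show "card (l \<inter> nth xs ` {..<((r - 1)\<^sup>2 + r) * s}) < r" if "l \<in> L" for l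
          using not that by (auto simp: W_def J)
        show "\<exists>l\<in>L. \<exists>K. K \<subseteq> l \<and> card K = r - 1 \<and> K \<subseteq> nth xs ` {i * s..<Suc i * s}"
          if "i < (r - 1)\<^sup>2 + r" for i
        proof -
          have "xs \<notin> U i"
            using not that J by blast
          then obtain l where l: "l \<in> L" "r - 1 \<le> card (l \<inter> nth xs ` {i * s..<Suc i * s})"
            using \<open>xs \<notin> U i\<close> by (auto simp: U_def not_less simp del: mult_Suc)
          then obtain K where "K \<subseteq> l \<inter> nth xs ` {i * s..<Suc i * s}" "card K = r - 1"
            by (meson obtain_subset_with_card_n)
          then show ?thesis
            using l by blast
        qed
      qed
      then show False
        using xs by simp
    qed
  qed auto
  also have "\<dots> \<le> measure_pmf.prob M (\<Union>i<J. U i) + measure_pmf.prob M W"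
    by (intro measure_Un_le) auto
  also have "measure_pmf.prob M (\<Union>i<J. U i) \<le> (\<Sum>i<J. measure_pmf.prob M (U i))"
    by (intro measure_pmf.finite_measure_subadditive_finite) auto
  also have "\<dots> \<le> (\<Sum>i<J. b)"
  proof (rule sum_mono)
    fix i assume "i \<in> {..<J}"
    then have "Suc i * s \<le> J * s"
      by (intro mult_le_mono1) simp
    then show "measure_pmf.prob M (U i) \<le> b"
      unfolding M_def U_def b_def using assms by (intro prob_no_near_rich_line_le) auto
  qed
  also have "measure_pmf.prob M W \<le> 2 * (real q)\<^sup>2 * (real (J * s) / real q) ^ r"
    unfolding M_def W_def using prob_random_ordering_rich_line_le[of "{..<J * s}" r] J rq by simp
  finally show ?thesis
    by (simp add: M_def b_def)
qed

text \<open>The random set is read as a prefix of random length \<open>N\<close>. It can fail to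
  percolate only if \<open>N < s\<close>, or the two hitting times differ, or the first
  \<open>s\<close> points contain no \<open>r\<close> collinear ones; otherwise
  \<open>tau_perc = tau_line \<le> s \<le> N\<close>.\<close>

lemma prob_not_percolates_le:
  assumes "0 < p" "p \<le> 1" "r > 0" "real s \<le> real (card P) * p / 2" "2 * r \<le> s" "2 * r \<le> q"
  shows "measure_pmf.prob (random_points P p) {A. \<not> percolates r P L A}
    \<le> 4 / (real (card P) * p)
      + measure_pmf.prob (random_ordering P) {xs. tau_line r L xs \<noteq> tau_perc r P L xs}
      + (2 * (real r)\<^sup>2 / real s + (4 * real r * (1 + real q / real s)) ^ r / (real q)\<^sup>2)"
proof -
  define D where "D = random_points P p"
  define M where "M = random_ordering P"
  define R where "R = (\<lambda>N. map_pmf (\<lambda>xs. set (take N xs)) M)"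
  define H where "H = map_pmf card D"
  define S where "S = {A. \<not> percolates r P L A}"
  define c where "c = measure_pmf.prob M {xs. tau_line r L xs \<noteq> tau_perc r P L xs}
      + (2 * (real r)\<^sup>2 / real s + (4 * real r * (1 + real q / real s)) ^ r / (real q)\<^sup>2)"
  have c_nonneg: "c \<ge> 0"
    unfolding c_def by (intro add_nonneg_nonneg) auto
  have D: "D = bind_pmf (H) R"
    unfolding D_def R_def M_def H_def using assms finite_points set_pmf_random_points[OF finite_points]
    by (intro exchangeable_set_eq_prefix_of_random_ordering pmf_random_points_cong_card) auto
  have "real (card P) * p \<le> real (card P)"
    using assms by (simp add: mult_left_le)
  then have s_le: "s \<le> card P"
    using assms(4) by linarith
  \<comment> \<open>Below \<open>s\<close> the trivial bound 1 is used; averaging over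
    \<open>N\<close> turns the indicator into the probability of a small set.\<close>
  have step: "measure_pmf.prob (R N) S \<le> indicator {..<s} N + c" for N
  proof (cases "N < s")
    case True
    then show ?thesis
      using add_mono[OF measure_pmf.prob_le_1[of "R N" S] c_nonneg] by simp
  next
    case False
    have "measure_pmf.prob (R N) S = measure_pmf.prob M {xs. \<not> percolates r P L (set (take N xs))}"
      by (simp add: R_def S_def vimage_def)
    also have "\<dots> \<le> measure_pmf.prob M ({xs. tau_line r L xs \<noteq> tau_perc r P L xs} \<union> {xs. \<forall>l\<in>L. card (l \<inter> nth xs ` {..<s}) < r})"
    proof (intro measure_pmf.finite_measure_mono_AE AE_pmfI impI)
      fix xs assume xs: "xs \<in> set_pmf M" "xs \<in> {xs. \<not> percolates r P L (set (take N xs))}"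
      have perm: "set xs = P" "distinct xs" "length xs = card P"
        using xs finite_points
        by (auto simp: M_def random_ordering_def length_finite_permutations_of_set permutations_of_setD)
      show "xs \<in> {xs. tau_line r L xs \<noteq> tau_perc r P L xs} \<union> {xs. \<forall>l\<in>L. card (l \<inter> nth xs ` {..<s}) < r}"
      proof (rule ccontr)
        assume "\<not> ?thesis"
        then obtain l where eq: "tau_line r L xs = tau_perc r P L xs"
          and l: "l \<in> L" "r \<le> card (l \<inter> nth xs ` {..<s})"
          by (auto simp: not_less)
        have "nth xs ` {..<s} = set (take s xs)"
          using nth_image[of s xs] perm s_le by (simp add: lessThan_atLeast0)
        then have "tau_line r L xs \<le> s"
          unfolding tau_line_def using l by (intro Least_le) auto
        then have tau: "tau_perc r P L xs \<le> N"
          using eq False by simp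
        \<comment> \<open>A witness for the \<open>LEAST\<close> in \<open>tau_perc\<close>: the
          full ordering is already \<open>P\<close> after 0 steps.\<close>
        have "percolates r P L (set (take (length xs) xs))"
          unfolding percolates_def by (rule exI[of _ 0]) (simp add: perm)
        then have "percolates r P L (set (take (tau_perc r P L xs) xs))"
          unfolding tau_perc_def by (rule LeastI)
        then have "percolates r P L (set (take N xs))"
          using set_take_subset_set_take[OF tau, of xs] set_take_subset[of N xs] perm
          by (intro percolates_mono[OF finite_points _ _ \<open>percolates r P L (set (take (tau_perc r P L xs) xs))\<close>]) auto
        then show False
          using xs by simp
      qed
    qed auto
    also have "\<dots> \<le> measure_pmf.prob M {xs. tau_line r L xs \<noteq> tau_perc r P L xs}
        + measure_pmf.prob M {xs. \<forall>l\<in>L. card (l \<inter> nth xs ` {..<s}) < r}"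
      by (intro measure_Un_le) auto
    also have "measure_pmf.prob M {xs. \<forall>l\<in>L. card (l \<inter> nth xs ` {..<s}) < r}
       \<le> 2 * (real r)\<^sup>2 / real s + (4 * real r * (1 + real q / real s)) ^ r / (real q)\<^sup>2"
      unfolding M_def using assms s_le by (intro prob_no_near_rich_line_le) auto
    finally show ?thesis
      using False by (simp add: c_def)
  qed
  have "measure_pmf.prob D S = measure_pmf.expectation (H) (\<lambda>N. measure_pmf.prob (R N) S)"
    by (subst D) (rule prob_bind_pmf)
  also have "\<dots> \<le> measure_pmf.expectation (H) (\<lambda>N. indicator {..<s} N + c)"
  proof (rule integral_mono)
    show "integrable (H) (\<lambda>N. measure_pmf.prob (R N) S)"
      by (rule measure_pmf.integrable_const_bound[where B = 1]) auto
    show "integrable (H) (\<lambda>N. indicator {..<s} N + c)"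
      by (rule measure_pmf.integrable_const_bound[where B = "1 + \<bar>c\<bar>"]) (auto simp: indicator_def)
  qed (rule step)
  also have "\<dots> = measure_pmf.prob (H) {..<s} + c"
    by (subst Bochner_Integration.integral_add) (auto intro!: integrable_real_indicator simp: less_top[symmetric])
  also have "measure_pmf.prob (H) {..<s} = measure_pmf.prob D {A. card A < s}"
    by (simp add: H_def vimage_def)
  also have "\<dots> \<le> 4 / (real (card P) * p)"
    unfolding D_def using assms finite_points card_points_pos by (intro prob_random_points_card_less) auto
  finally show ?thesis
    by (simp add: D_def S_def c_def M_def)
qed

lemma prob_percolates_le:
  assumes "0 \<le> p" "p \<le> 1" "r \<le> q + 1"
  shows "measure_pmf.prob (random_points P p) {A. percolates r P L A} \<le> 2 * (real q)\<^sup>2 * (2 * real q * p) ^ r"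
proof -
  have "measure_pmf.prob (random_points P p) {A. percolates r P L A}
      \<le> measure_pmf.prob (random_points P p) {A. \<exists>l\<in>L. card (l \<inter> A) \<ge> r}"
  proof (intro measure_pmf.finite_measure_mono subsetI)
    fix A assume A: "A \<in> {A. percolates r P L A}"
    show "A \<in> {A. \<exists>l\<in>L. card (l \<inter> A) \<ge> r}"
    proof (rule ccontr)
      assume "\<not> ?thesis"
      then have no: "\<And>l. l \<in> L \<Longrightarrow> card (l \<inter> A) < r"
        by (auto simp: not_le)
      obtain l where "l \<in> L"
        using lines_nonempty by auto
      then have "A \<noteq> P"
        using no[of l] card_line line_subset assms(3) by (auto simp: Int_absorb2)
      then show False
        using A not_percolates_if_no_rich_line[OF _ no] by simp
    qed
  qed auto
  also have "\<dots> \<le> 2 * (real q)\<^sup>2 * (2 * real q * p) ^ r"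
    using assms by (rule prob_random_points_rich_line_le)
  finally show ?thesis .
qed

end

section \<open>Asymptotics\<close>

lemma prob_tendsto_1I:
  fixes M :: "'i \<Rightarrow> 'b pmf"
  assumes "eventually (\<lambda>q. measure_pmf.prob (M q) {w. \<not> Q q w} \<le> g q) F" "(g \<longlongrightarrow> 0) F"
  shows "((\<lambda>q. measure_pmf.prob (M q) {w. Q q w}) \<longlongrightarrow> 1) F"
proof -
  have "((\<lambda>q. measure_pmf.prob (M q) {w. \<not> Q q w}) \<longlongrightarrow> 0) F"
    by (rule Lim_null_comparison[OF _ assms(2)]) (use assms(1) in simp)
  then have "((\<lambda>q. 1 - measure_pmf.prob (M q) {w. \<not> Q q w}) \<longlongrightarrow> 1 - 0) F"
    by (intro tendsto_intros)
  moreover have "1 - measure_pmf.prob (M q) {w. \<not> Q q w} = measure_pmf.prob (M q) {w. Q q w}" for q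
    using measure_pmf.prob_compl[of "{w. Q q w}" "M q"] by (simp add: Compl_eq_Diff_UNIV[symmetric] Collect_neg_eq)
  ultimately show ?thesis by simp
qed

lemma eventually_powr_ge:
  assumes "\<beta> > 0"
  shows "eventually (\<lambda>q. c \<le> real q powr \<beta>) sequentially"
proof -
  define d where "d = max c 1"
  have "eventually (\<lambda>q. real q \<ge> d powr (1 / \<beta>)) sequentially"
    using filterlim_real_sequentially by (simp add: filterlim_at_top)
  then show ?thesis
  proof eventually_elim
    case (elim q)
    then have "(d powr (1 / \<beta>)) powr \<beta> \<le> real q powr \<beta>"
      using assms by (intro powr_mono2) auto
    then show ?case
      using assms by (simp add: powr_powr d_def)
  qed
qed

text \<open>The essential use of \<open>r \<ge> 3\<close>: it gives
  \<open>r\<^sup>2 > 2 * r + 1\<close>, which fails at \<open>r = 2\<close>, where the blocks would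
  not grow with \<open>q\<close>.\<close>

lemma block_exponent_pos:
  assumes "r \<ge> 3"
  shows "1 - 2 / real r - 1 / (real r)\<^sup>2 > 0"
proof -
  have "3 * real r \<le> real r * real r"
    using assms(1) by (intro mult_right_mono) auto
  moreover have "real r \<ge> 3"
    using assms(1) by simp
  ultimately have "2 * real r + 1 < (real r)\<^sup>2"
    unfolding power2_eq_square by linarith
  then have "((real r)\<^sup>2 - 2 * real r - 1) / (real r)\<^sup>2 > 0"
    using assms by (intro divide_pos_pos) auto
  then show ?thesis
    using assms by (simp add: diff_divide_distrib power2_eq_square)
qed

text \<open>The block length \<open>q powr (1 - 2 / r - 1 / r\<^sup>2)\<close> lies strictly between the threshold
  \<open>q powr (1 - 2 / (r - 1))\<close> for collinear \<open>(r - 1)\<close>-sets and the threshold \<open>q powr (1 - 2 / r)\<close>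
  for collinear \<open>r\<close>-sets.\<close>

lemma taus_bound_tendsto_0:
  fixes r :: nat and \<beta> J :: real and s :: "nat \<Rightarrow> nat"
  assumes "r \<ge> 3" "J \<ge> 0" and \<beta>: "\<beta> = 1 - 2 / real r - 1 / (real r)\<^sup>2"
    and s: "s = (\<lambda>q. nat \<lfloor>real q powr \<beta>\<rfloor>)" and k: "k = r - 1"
  shows "((\<lambda>q. J * (2 * (real k)\<^sup>2 / real (s q) + (4 * real k * (1 + real q / real (s q))) ^ k / (real q)\<^sup>2)
      + 2 * (real q)\<^sup>2 * (J * real (s q) / real q) ^ r) \<longlongrightarrow> 0) sequentially"
proof -
  have r0: "real r > 0"
    using assms(1) by simp
  have \<beta>0: "\<beta> > 0"
    using block_exponent_pos[OF assms(1)] by (simp add: \<beta>)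
  have "2 / real r > 0" "1 / (real r)\<^sup>2 > 0"
    using r0 by auto
  then have \<beta>1: "\<beta> < 1"
    unfolding \<beta> by linarith
  \<comment> \<open>This exponent governs the same-line term for \<open>(r - 1)\<close>-sets, the
    one of \<open>e2\<close> the collinear \<open>r\<close>-sets. The correction
    \<open>1 / r\<^sup>2\<close> in \<open>\<beta>\<close> is what pushes the second below 0, and it
    is small enough to keep the first negative.\<close>
  have "(1 - \<beta>) * real k - 2 = - (real r + 1) / (real r)\<^sup>2"
    using assms(1) by (simp add: \<beta> k of_nat_diff field_simps power2_eq_square)
  then have e1: "(1 - \<beta>) * real k - 2 < 0"
    using r0 by (simp add: divide_neg_pos)
  have "2 + real r * (\<beta> - 1) = - 1 / real r"
    using r0 by (simp add: \<beta> field_simps power2_eq_square)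
  then have e2: "2 + real r * (\<beta> - 1) < 0"
    using r0 by simp
  \<comment> \<open>Rounding down loses at most a factor 2 once
    \<open>q powr \<beta> \<ge> 2\<close>. This doubles the first constant to 4 and gives
    \<open>1 + q / s \<le> 3 * q powr (1 - \<beta>)\<close>, hence 12.\<close>
  define h where "h = (\<lambda>q. J * (4 * (real k)\<^sup>2 * real q powr (- \<beta>) + (12 * real k) ^ k * real q powr ((1 - \<beta>) * real k - 2))
      + 2 * J ^ r * real q powr (2 + real r * (\<beta> - 1)))"
  have "(h \<longlongrightarrow> J * (4 * (real k)\<^sup>2 * 0 + (12 * real k) ^ k * 0) + 2 * J ^ r * 0) sequentially"
    unfolding h_def
    by (intro tendsto_intros tendsto_neg_powr filterlim_real_sequentially e1 e2) (use \<beta>0 in simp)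
  then have h: "(h \<longlongrightarrow> 0) sequentially"
    by simp
  show ?thesis
  proof (rule Lim_null_comparison[OF _ h])
    show "eventually (\<lambda>q. norm (J * (2 * (real k)\<^sup>2 / real (s q) + (4 * real k * (1 + real q / real (s q))) ^ k / (real q)\<^sup>2)
      + 2 * (real q)\<^sup>2 * (J * real (s q) / real q) ^ r) \<le> h q) sequentially"
      using eventually_powr_ge[OF \<beta>0, of 2] eventually_gt_at_top[of 0]
    proof eventually_elim
      case (elim q)
      define x where "x = real q"
      define y where "y = real (s q)"
      have x: "x \<ge> 1" "x > 0"
        using elim by (auto simp: x_def)
      have power_powr: "(x powr a) ^ j = x powr (a * real j)" for a j
        using x by (simp add: powr_powr flip: powr_realpow)
      have xb: "x powr \<beta> \<ge> 2"
        using elim by (simp add: x_def)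
      have y_le: "y \<le> x powr \<beta>"
        by (simp add: y_def s x_def)
      have "x powr \<beta> - 1 \<le> y"
        unfolding y_def s x_def by linarith
      then have y_ge: "x powr \<beta> / 2 \<le> y"
        using xb by linarith
      have y0: "y > 0"
        using y_ge xb by linarith
      have t1: "2 * (real k)\<^sup>2 / y \<le> 4 * (real k)\<^sup>2 * x powr (- \<beta>)"
      proof -
        have "2 * (real k)\<^sup>2 / y \<le> 2 * (real k)\<^sup>2 / (x powr \<beta> / 2)"
          using y_ge y0 xb by (intro divide_left_mono mult_pos_pos) auto
        also have "\<dots> = 4 * (real k)\<^sup>2 * x powr (- \<beta>)"
          by (simp add: powr_minus_divide)
        finally show ?thesis .
      qed
      have t2: "(4 * real k * (1 + x / y)) ^ k / x\<^sup>2 \<le> (12 * real k) ^ k * x powr ((1 - \<beta>) * real k - 2)"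
      proof -
        have "x / y \<le> x / (x powr \<beta> / 2)"
          using y_ge y0 x xb by (intro divide_left_mono mult_pos_pos) auto
        also have "\<dots> = 2 * x powr (1 - \<beta>)"
          using x by (simp add: powr_diff)
        finally have "1 + x / y \<le> 3 * x powr (1 - \<beta>)"
          using ge_one_powr_ge_zero[of x "1 - \<beta>"] x \<beta>1 by simp
        then have "(4 * real k * (1 + x / y)) ^ k \<le> (4 * real k * (3 * x powr (1 - \<beta>))) ^ k"
          using x y0 by (intro power_mono mult_left_mono) auto
        also have "4 * real k * (3 * x powr (1 - \<beta>)) = (12 * real k) * x powr (1 - \<beta>)"
          by simp
        also have "\<dots> ^ k = (12 * real k) ^ k * x powr ((1 - \<beta>) * real k)"
          by (simp only: power_mult_distrib power_powr)
        finally have "(4 * real k * (1 + x / y)) ^ k / x\<^sup>2 \<le> (12 * real k) ^ k * x powr ((1 - \<beta>) * real k) / x\<^sup>2"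
          by (intro divide_right_mono) auto
        also have "\<dots> = (12 * real k) ^ k * x powr ((1 - \<beta>) * real k - 2)"
          using x by (simp add: powr_diff)
        finally show ?thesis .
      qed
      have t3: "2 * x\<^sup>2 * (J * y / x) ^ r \<le> 2 * J ^ r * x powr (2 + real r * (\<beta> - 1))"
      proof -
        have "(J * y / x) ^ r \<le> (J * x powr \<beta> / x) ^ r"
          using x y0 y_le assms(2) by (intro power_mono divide_right_mono mult_left_mono) auto
        also have "\<dots> = (J * x powr (\<beta> - 1)) ^ r"
          using x by (simp add: powr_diff)
        also have "\<dots> = J ^ r * x powr (real r * (\<beta> - 1))"
          by (simp only: power_mult_distrib power_powr mult.commute[of "real r"])
        finally have "2 * x\<^sup>2 * (J * y / x) ^ r \<le> 2 * x\<^sup>2 * (J ^ r * x powr (real r * (\<beta> - 1)))"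
          by (intro mult_left_mono) auto
        also have "\<dots> = 2 * J ^ r * x powr (2 + real r * (\<beta> - 1))"
          using x by (simp add: powr_add)
        finally show ?thesis .
      qed
      have "J * (2 * (real k)\<^sup>2 / y + (4 * real k * (1 + x / y)) ^ k / x\<^sup>2) + 2 * x\<^sup>2 * (J * y / x) ^ r \<le> h q"
        unfolding h_def x_def[symmetric] by (intro add_mono mult_left_mono t1 t2 t3 assms(2))
      moreover have "0 \<le> J * (2 * (real k)\<^sup>2 / y + (4 * real k * (1 + x / y)) ^ k / x\<^sup>2) + 2 * x\<^sup>2 * (J * y / x) ^ r"
        using x y0 assms(2) by (intro add_nonneg_nonneg mult_nonneg_nonneg divide_nonneg_nonneg zero_le_power) auto
      ultimately show ?case
        by (simp add: x_def y_def)
    qed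
  qed
qed

text \<open>The filter lets \<open>q\<close> tend to infinity inside the set \<open>S\<close> of
  orders. The bound depends on \<open>q\<close> alone, so it does not matter which plane of each
  order is chosen.\<close>

lemma prob_taus_differ_tendsto_0:
  fixes r :: nat and S :: "nat set" and P :: "nat \<Rightarrow> 'a set" and L :: "nat \<Rightarrow> 'a set set"
  assumes "r \<ge> 3" and plane: "\<And>q. q \<in> S \<Longrightarrow> finite_projective_plane q (P q) (L q)"
  shows "((\<lambda>q. measure_pmf.prob (random_ordering (P q)) {xs. tau_line r (L q) xs \<noteq> tau_perc r (P q) (L q) xs})
    \<longlongrightarrow> 0) (inf sequentially (principal S))"
proof -
  define F where "F = inf sequentially (principal S)"
  define \<beta> where "\<beta> = 1 - 2 / real r - 1 / (real r)\<^sup>2"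
  define s where "s = (\<lambda>q. nat \<lfloor>real q powr \<beta>\<rfloor>)"
  define J where "J = (r - 1)\<^sup>2 + r"
  define k where "k = r - 1"
  have F_le: "F \<le> sequentially"
    by (simp add: F_def)
  have \<beta>0: "\<beta> > 0"
    using block_exponent_pos[OF assms(1)] by (simp add: \<beta>_def)
  have "2 / real r \<ge> 0" "1 / (real r)\<^sup>2 \<ge> 0"
    by auto
  then have \<beta>1: "\<beta> \<le> 1"
    unfolding \<beta>_def by linarith
  have "eventually (\<lambda>q. real (2 * k + 1) \<le> real q powr \<beta>) F"
    using eventually_powr_ge[OF \<beta>0] F_le filter_leD by blast
  \<comment> \<open>With \<open>J \<le> q\<close> and \<open>s q \<le> q\<close>, the blocks occupy
    at most \<open>q\<^sup>2\<close> positions and fit into the ordering.\<close>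
  moreover have "eventually (\<lambda>q. q \<ge> 2 * k + J + 1) F"
    using eventually_ge_at_top F_le filter_leD by blast
  moreover have "eventually (\<lambda>q. q \<in> S) F"
    by (simp add: F_def eventually_inf_principal)
  ultimately have "eventually (\<lambda>q. norm (measure_pmf.prob (random_ordering (P q)) {xs. tau_line r (L q) xs \<noteq> tau_perc r (P q) (L q) xs})
      \<le> real J * (2 * (real k)\<^sup>2 / real (s q) + (4 * real k * (1 + real q / real (s q))) ^ k / (real q)\<^sup>2)
        + 2 * (real q)\<^sup>2 * (real J * real (s q) / real q) ^ r) F"
  proof eventually_elim
    case (elim q)
    interpret finite_projective_plane q "P q" "L q"
      using plane elim by blast
    have "real (s q) \<le> real q powr \<beta>"
      by (simp add: s_def)
    also have "\<dots> \<le> real q powr 1"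
      using elim \<beta>1 by (intro powr_mono) auto
    finally have "s q \<le> q"
      by simp
    then have "J * s q \<le> q * q"
      using elim by (intro mult_le_mono) auto
    then have Js: "J * s q \<le> card (P q)"
      by (simp add: card_points power2_eq_square)
    have ks: "2 * k \<le> s q"
      using elim(1) unfolding s_def by linarith
    show ?case
      using prob_taus_differ_le[of r "s q" J] assms(1) ks elim Js by (simp add: J_def k_def)
  qed
  moreover have "((\<lambda>q. real J * (2 * (real k)\<^sup>2 / real (s q) + (4 * real k * (1 + real q / real (s q))) ^ k / (real q)\<^sup>2)
        + 2 * (real q)\<^sup>2 * (real J * real (s q) / real q) ^ r) \<longlongrightarrow> 0) F"
    using taus_bound_tendsto_0[OF assms(1), of "real J", OF _ \<beta>_def s_def k_def] tendsto_mono[OF F_le] by simp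
  ultimately show ?thesis
    unfolding F_def by (rule Lim_null_comparison)
qed

text \<open>The origin of the threshold: at this density a line carries about
  \<open>q powr (- (2 / r))\<close> chosen points, and the \<open>r\<close>-th power of this cancels
  the roughly \<open>q\<^sup>2\<close> lines.\<close>

lemma threshold_powr:
  assumes "q > 0" "r > 0"
  shows "real q * real q powr (- ((real r + 2) / real r)) = real q powr (- (2 / real r))"
    and "(real q powr (- (2 / real r))) ^ r = 1 / (real q)\<^sup>2"
proof -
  have "real q * real q powr (- ((real r + 2) / real r)) = real q powr (1 + - ((real r + 2) / real r))"
    unfolding powr_add using assms by simp
  also have "1 + - ((real r + 2) / real r) = - (2 / real r)"
    using assms by (simp add: field_simps)
  finally show "real q * real q powr (- ((real r + 2) / real r)) = real q powr (- (2 / real r))" .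
  have "(real q powr (- (2 / real r))) ^ r = real q powr (- (2 / real r) * real r)"
    using assms by (simp add: powr_powr flip: powr_realpow)
  also have "- (2 / real r) * real r = - 2"
    using assms by simp
  also have "real q powr - 2 = 1 / (real q)\<^sup>2"
    using assms by (simp add: powr_minus_divide)
  finally show "(real q powr (- (2 / real r))) ^ r = 1 / (real q)\<^sup>2" .
qed

lemma (in finite_projective_plane) prob_percolates_below_threshold:
  assumes "\<omega> \<ge> 1" "r > 0" "r \<le> q + 1"
  shows "measure_pmf.prob (random_points P (real q powr (- ((real r + 2) / real r)) / \<omega>)) {A. percolates r P L A}
    \<le> 2 * (2 / \<omega>) ^ r"
proof -
  define p where "p = real q powr (- ((real r + 2) / real r)) / \<omega>"
  have q: "q > 0"
    using order_ge_2 by simp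
  have "real q powr (- ((real r + 2) / real r)) \<le> real q powr 0"
    using q by (intro powr_mono) auto
  then have p: "0 \<le> p" "p \<le> 1"
    using assms q by (auto simp: p_def)
  have "2 * real q * p = 2 / \<omega> * real q powr (- (2 / real r))"
    using threshold_powr(1)[OF q assms(2)] by (simp add: p_def field_simps)
  then have "(2 * real q * p) ^ r = (2 / \<omega>) ^ r * (1 / (real q)\<^sup>2)"
    by (simp only: power_mult_distrib threshold_powr(2)[OF q assms(2)])
  then show ?thesis
    using prob_percolates_le[OF p assms(3)] q by (simp add: p_def)
qed

lemma (in finite_projective_plane) prob_not_percolates_above_threshold:
  assumes "r \<ge> 2" "2 * r \<le> q" "\<omega> \<ge> 8 * real r"
  shows "measure_pmf.prob (random_points P (real q powr (- ((real r + 2) / real r)) * \<omega>)) {A. \<not> percolates r P L A}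
    \<le> 4 / \<omega> + measure_pmf.prob (random_ordering P) {xs. tau_line r L xs \<noteq> tau_perc r P L xs}
      + (8 * (real r)\<^sup>2 / \<omega> + (4 * real r * (real q powr (- (2 / real r)) + 4 / \<omega>)) ^ r)"
    (is "_ \<le> ?b")
proof -
  define x where "x = real q"
  define p where "p = x powr (- ((real r + 2) / real r)) * \<omega>"
  define n where "n = real (card P)"
  have q: "q > 0"
    using order_ge_2 by simp
  have r: "r > 0" "real r \<ge> 2"
    using assms by auto
  have x: "x > 0" "x \<ge> 1"
    using q by (auto simp: x_def)
  have \<omega>: "\<omega> > 0"
    using assms r by linarith
  have p0: "p > 0"
    using x \<omega> by (simp add: p_def)
  have b0: "?b \<ge> 0"
    using \<omega> by (intro add_nonneg_nonneg) auto
  have xp: "x * p = x powr (- (2 / real r)) * \<omega>"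
    using threshold_powr(1)[OF q r(1)] by (simp add: p_def x_def mult.assoc[symmetric])
  show ?thesis
  proof (cases "p \<ge> 1")
    \<comment> \<open>A fast growing \<open>\<omega>\<close> can push \<open>p\<close> to 1 or
      beyond; the Bernoulli parameter is then truncated to 1 and the random set is all of
      \<open>P\<close>.\<close>
    case True
    have "P \<in> {A. percolates r P L A}"
      unfolding percolates_def by (auto intro: exI[of _ 0])
    moreover have "A = P" if A: "A \<in> set_pmf (random_points P p)" for A
    proof -
      have "bernoulli_pmf p = return_pmf True"
        using True by (intro pmf_eqI) (auto simp: bernoulli_pmf.rep_eq split: bool.split)
      then show ?thesis
        using A finite_points by (auto simp: random_points_def Pi_pmf_return_pmf)
    qed
    ultimately have "measure_pmf.prob (random_points P p) {A. \<not> percolates r P L A} = 0"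
      by (subst measure_pmf_zero_iff) auto
    then show ?thesis
      using b0 by (simp add: p_def x_def)
  next
    case False
    \<comment> \<open>Half the expected size of the random set. As \<open>n * p \<ge> 16\<close>,
      rounding leaves at least \<open>n * p / 4\<close>, and \<open>\<omega> \<ge> 8 * r\<close>
      then yields \<open>s \<ge> 2 * r\<close>.\<close>
    define s where "s = nat \<lfloor>n * p / 2\<rfloor>"
    have "x\<^sup>2 * p \<le> n * p"
      using p0 by (intro mult_right_mono) (auto simp: n_def x_def card_points)
    then have np: "x * (x powr (- (2 / real r)) * \<omega>) \<le> n * p"
      using xp by (simp add: power2_eq_square mult.assoc)
    \<comment> \<open>Since \<open>1 - 2 / r \<ge> 0\<close>, the expected size \<open>n * p\<close>
      is at least \<open>\<omega>\<close>.\<close>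
    have "x powr 0 \<le> x powr (1 + - (2 / real r))"
      using x r by (intro powr_mono) auto
    also have "\<dots> = x * x powr (- (2 / real r))"
      unfolding powr_add using x by simp
    finally have "1 \<le> x * x powr (- (2 / real r))"
      using x by simp
    then have "\<omega> \<le> x * x powr (- (2 / real r)) * \<omega>"
      using \<omega> by simp
    then have np\<omega>: "\<omega> \<le> n * p"
      using np by (simp add: mult.assoc)
    then have np_ge: "n * p \<ge> 16"
      using assms r by linarith
    have s_le: "real s \<le> n * p / 2"
      unfolding s_def using np_ge by (intro of_nat_floor) simp
    have s_ge: "n * p / 4 \<le> real s"
      using np_ge unfolding s_def by linarith
    have s2: "2 * r \<le> s"
      using s_ge np\<omega> assms(3) by linarith
    have s0: "real s > 0"
      using s2 r by simp
    have "measure_pmf.prob (random_points P p) {A. \<not> percolates r P L A}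
        \<le> 4 / (n * p) + measure_pmf.prob (random_ordering P) {xs. tau_line r L xs \<noteq> tau_perc r P L xs}
        + (2 * (real r)\<^sup>2 / real s + (4 * real r * (1 + real q / real s)) ^ r / (real q)\<^sup>2)"
      unfolding n_def using False p0 r(1) s_le s2 assms(2)
      by (intro prob_not_percolates_le) (auto simp: n_def)
    also have "\<dots> \<le> ?b"
    proof (intro add_mono order_refl)
      show "4 / (n * p) \<le> 4 / \<omega>"
        using np\<omega> \<omega> by (intro frac_le) auto
      have "2 * (real r)\<^sup>2 / real s \<le> 2 * (real r)\<^sup>2 / (\<omega> / 4)"
        using s_ge np\<omega> \<omega> s0 by (intro divide_left_mono mult_pos_pos) auto
      then show "2 * (real r)\<^sup>2 / real s \<le> 8 * (real r)\<^sup>2 / \<omega>"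
        by simp
      have "x * (x powr (- (2 / real r)) * \<omega>) / 4 \<le> real s"
        using np s_ge by linarith
      then have "x * x powr (- (2 / real r)) \<le> 4 / \<omega> * real s"
        using \<omega> by (simp add: field_simps)
      then have "x powr (- (2 / real r)) * (x / real s) \<le> 4 / \<omega>"
        using s0 by (simp add: field_simps)
      \<comment> \<open>The divisor \<open>q\<^sup>2\<close> is moved into the \<open>r\<close>-th
        power as a factor \<open>q powr (- (2 / r))\<close>. This offsets the possibly unbounded
        \<open>q / s\<close> and leaves at most \<open>4 / \<omega>\<close>.\<close>
      then have "(1 + x / real s) * x powr (- (2 / real r)) \<le> x powr (- (2 / real r)) + 4 / \<omega>"
        by (simp add: algebra_simps)
      then have "(4 * real r * ((1 + x / real s) * x powr (- (2 / real r)))) ^ r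
          \<le> (4 * real r * (x powr (- (2 / real r)) + 4 / \<omega>)) ^ r"
        using x s0 by (intro power_mono mult_left_mono) auto
      also have "(4 * real r * ((1 + x / real s) * x powr (- (2 / real r)))) ^ r
          = (4 * real r * (1 + x / real s)) ^ r * (x powr (- (2 / real r))) ^ r"
        by (simp only: power_mult_distrib mult.assoc)
      also have "(x powr (- (2 / real r))) ^ r = 1 / x\<^sup>2"
        unfolding x_def by (rule threshold_powr(2)[OF q r(1)])
      finally show "(4 * real r * (1 + real q / real s)) ^ r / (real q)\<^sup>2
          \<le> (4 * real r * (real q powr (- (2 / real r)) + 4 / \<omega>)) ^ r"
        by (simp add: x_def)
    qed
    finally show ?thesis
      by (simp add: p_def x_def)
  qed
qed

theorem theorem3:
  fixes r :: nat and S :: "nat set" and \<omega> :: "nat \<Rightarrow> real"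
    and P :: "nat \<Rightarrow> 'a set" and L :: "nat \<Rightarrow> 'a set set"
  assumes "r \<ge> 3"
    and "\<And>q. q \<in> S \<Longrightarrow> finite_projective_plane q (P q) (L q)"
    and "\<And>q. q \<in> S \<Longrightarrow> \<omega> q > 0"
    and "filterlim \<omega> at_top (inf sequentially (principal S))"
  shows
    "((\<lambda>q. measure_pmf.prob
             (random_points (P q) (real q powr (- ((real r + 2) / real r)) / \<omega> q))
             {A. \<not> percolates r (P q) (L q) A})
        \<longlongrightarrow> 1) (inf sequentially (principal S)) \<and>
     ((\<lambda>q. measure_pmf.prob
             (random_points (P q) (real q powr (- ((real r + 2) / real r)) * \<omega> q))
             {A. percolates r (P q) (L q) A})
        \<longlongrightarrow> 1) (inf sequentially (principal S)) \<and>
     ((\<lambda>q. measure_pmf.prob (random_ordering (P q))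
             {xs. tau_line r (L q) xs = tau_perc r (P q) (L q) xs})
        \<longlongrightarrow> 1) (inf sequentially (principal S))"
proof (intro conjI)
  define F where "F = inf sequentially (principal S)"
  have F_le: "F \<le> sequentially"
    by (simp add: F_def)
  have in_S: "eventually (\<lambda>q. q \<in> S) F"
    by (simp add: F_def eventually_inf_principal)
  have q_ge: "eventually (\<lambda>q. q \<ge> c) F" for c :: nat
    using eventually_ge_at_top F_le filter_leD by blast
  have \<omega>_ge: "eventually (\<lambda>q. \<omega> q \<ge> c) F" for c
    using assms(4) by (simp add: F_def filterlim_at_top)
  have \<omega>_inv: "((\<lambda>q. c / \<omega> q) \<longlongrightarrow> 0) F" for c
    using assms(4) unfolding F_def[symmetric]
    by (intro tendsto_divide_0[OF tendsto_const] filterlim_at_top_imp_at_infinity)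
  have taus: "((\<lambda>q. measure_pmf.prob (random_ordering (P q)) {xs. tau_line r (L q) xs \<noteq> tau_perc r (P q) (L q) xs}) \<longlongrightarrow> 0) F"
    unfolding F_def using assms(1,2) by (rule prob_taus_differ_tendsto_0)
  have powr: "((\<lambda>q. real q powr (- (2 / real r))) \<longlongrightarrow> 0) F"
    using assms(1) by (intro tendsto_mono[OF F_le] tendsto_neg_powr filterlim_real_sequentially) simp
  show "((\<lambda>q. measure_pmf.prob
             (random_points (P q) (real q powr (- ((real r + 2) / real r)) / \<omega> q))
             {A. \<not> percolates r (P q) (L q) A})
        \<longlongrightarrow> 1) (inf sequentially (principal S))"
    unfolding F_def[symmetric]
  proof (rule prob_tendsto_1I)
    show "eventually (\<lambda>q. measure_pmf.prob (random_points (P q) (real q powr (- ((real r + 2) / real r)) / \<omega> q))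
        {A. \<not> \<not> percolates r (P q) (L q) A} \<le> 2 * (2 / \<omega> q) ^ r) F"
      using in_S q_ge[of r] \<omega>_ge[of 1]
    proof eventually_elim
      case (elim q)
      interpret finite_projective_plane q "P q" "L q"
        using assms(2) elim by blast
      show ?case
        using prob_percolates_below_threshold[of "\<omega> q" r] elim assms(1) by simp
    qed
    have "((\<lambda>q. 2 * (2 / \<omega> q) ^ r) \<longlongrightarrow> 2 * 0 ^ r) F"
      by (intro tendsto_intros \<omega>_inv)
    then show "((\<lambda>q. 2 * (2 / \<omega> q) ^ r) \<longlongrightarrow> 0) F"
      using assms(1) by (simp add: power_0_left)
  qed
  show "((\<lambda>q. measure_pmf.prob
             (random_points (P q) (real q powr (- ((real r + 2) / real r)) * \<omega> q))
             {A. percolates r (P q) (L q) A})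
        \<longlongrightarrow> 1) (inf sequentially (principal S))"
    unfolding F_def[symmetric]
  proof (rule prob_tendsto_1I)
    let ?b = "\<lambda>q. 4 / \<omega> q + measure_pmf.prob (random_ordering (P q)) {xs. tau_line r (L q) xs \<noteq> tau_perc r (P q) (L q) xs}
      + (8 * (real r)\<^sup>2 / \<omega> q + (4 * real r * (real q powr (- (2 / real r)) + 4 / \<omega> q)) ^ r)"
    show "eventually (\<lambda>q. measure_pmf.prob (random_points (P q) (real q powr (- ((real r + 2) / real r)) * \<omega> q))
        {A. \<not> percolates r (P q) (L q) A} \<le> ?b q) F"
      using in_S q_ge[of "2 * r"] \<omega>_ge[of "8 * real r"]
    proof eventually_elim
      case (elim q)
      interpret finite_projective_plane q "P q" "L q"
        using assms(2) elim by blast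
      show ?case
        using elim assms(1) by (intro prob_not_percolates_above_threshold) auto
    qed
    have "(?b \<longlongrightarrow> 0 + 0 + (0 + (4 * real r * (0 + 0)) ^ r)) F"
      by (intro tendsto_add tendsto_power tendsto_mult tendsto_const \<omega>_inv taus powr)
    then show "(?b \<longlongrightarrow> 0) F"
      using assms(1) by (simp add: power_0_left)
  qed
  show "((\<lambda>q. measure_pmf.prob (random_ordering (P q))
             {xs. tau_line r (L q) xs = tau_perc r (P q) (L q) xs})
        \<longlongrightarrow> 1) (inf sequentially (principal S))"
    unfolding F_def[symmetric] by (rule prob_tendsto_1I[OF _ taus]) simp
qed

end
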